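(* Let $E$ be a separable Banach space and let $(f_n)_n$ be a sequence of $\mathbb{T}\otimes\mathcal{B}(E)$-measurable integrands $f_n:\Omega\times E\to\overline{\mathbb{R}}$. Let $f$ be the pointwise weak lower sequential epi-limit integrand, $f(\omega,e)=(seq\,\sigma\text{-}li_e f_n(\omega,\cdot))(e)$ for all $(\omega,e)\in\Omega\times E$. Under one of the following assumptions the integrand $f^*$ is normal on $\Omega\times E^*_{\sigma^*}$ (and moreover $f^{**}$ is normal on $\Omega\times E_\sigma$): (a) the sequence $(f_n)_n$ is quasi inf-$\sigma$-compact for every slope; (b) the Banach space $E$ is reflexive and separable.
   Context: $(\Omega,\mathbb{T},\mu)$ is a measure space with $\mu$ a $\sigma$-finite positive measure and $\mathbb{T}$ $\mu$-complete. $\sigma=\sigma(E,E^* )$, $\sigma^*=\sigma(E^*,E)$; $E_\sigma$, $E^*_{\sigma^*}$ denote $E$, $E^*$ with these topologies, and $\mathcal{B}(\cdot)$ the Borel $\sigma$-algebra. $(seq\,\sigma\text{-}li_e f_n(\omega,\cdot))(e)=\inf\{\liminf_n f_n(\omega,e_n): (e_n)_n\text{ in }E,\ e_n\to e\text{ weakly}\}$. $f^*(\omega,e^* )=\sup_{e\in E}(\langle e^*,e\rangle-f(\omega,e))$ on $\Omega\times E^*$, and $f^{**}(\omega,e)=\sup_{e^*\in E^*}(\langle e^*,e\rangle-f^*(\omega,e^* ))$ on $\Omega\times E$. For a topological space $(G,\tau)$, an integrand $g:\Omega\times G\to\overline{\mathbb{R}}$ is normal on $\Omega\times G_\tau$ if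 it is $\mathbb{T}\otimes\mathcal{B}(G_\tau)$-measurable and $g(\omega,\cdot)$ is $\tau$-lower semicontinuous for every $\omega\in\Omega$. A function $h:E\to\overline{\mathbb{R}}$ is inf-$\sigma$-compact for every slope if for every $e^*\in E^*$ all sublevel sets $\{e: h(e)-\langle e^*,e\rangle\le r\}$, $r\in\mathbb{R}$, are weakly compact. The sequence $(f_n)_n$ is quasi inf-$\sigma$-compact for every slope if for every $\omega\in\Omega$ there are a function $h$ inf-$\sigma$-compact for every slope and $n_0$ with $f_n(\omega,\cdot)\ge h$ for all $n\ge n_0$. *)

theory Defs
  imports "HOL-Analysis.Analysis"
begin

text \<open>
  A separable Banach space is a type of sort \<open>{banach, second_countable_topology}\<close>, as in the
  library's Bochner integration. The next two facts confirm that, for metric spaces, the class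
  axiom of \<open>second_countable_topology\<close> says exactly that the space is separable.
\<close>

lemma separable_imp_second_countable_axiom:
  assumes "separable_space (euclidean :: 'a::metric_space topology)"
  shows "\<exists>B :: 'a set set. countable B \<and> open = generate_topology B"
proof -
  obtain D :: "'a set" where D: "countable D" "closure D = UNIV"
    using assms by (auto simp: separable_space_def)
  define B where "B = (\<lambda>(d, n). ball d (1 / real (Suc n))) ` (D \<times> (UNIV :: nat set))"
  have "countable B"
    unfolding B_def using D(1) by auto
  moreover have "topological_basis B"
  proof (rule topological_basisI)
    show "open b" if "b \<in> B" for b
      using that by (auto simp: B_def)
    fix U and x :: 'a
    assume "open U" "x \<in> U"
    then obtain e where e: "e > 0" "ball x e \<subseteq> U"
      using open_contains_ball by blast
    obtain n where n: "1 / real (Suc n) < e / 2"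
      using e(1) nat_approx_posE[of "e / 2"] by (metis half_gt_zero)
    have "x \<in> closure D"
      using D(2) by simp
    then obtain d where d: "d \<in> D" "dist d x < 1 / real (Suc n)"
      unfolding closure_approachable by (meson of_nat_0_less_iff zero_less_Suc zero_less_divide_1_iff)
    have "ball d (1 / real (Suc n)) \<subseteq> ball x e"
    proof
      fix y assume "y \<in> ball d (1 / real (Suc n))"
      then have "dist d y < 1 / real (Suc n)" by simp
      then show "y \<in> ball x e"
        using dist_triangle[of x y d] d(2) n by (simp add: dist_commute)
    qed
    then show "\<exists>b\<in>B. x \<in> b \<and> b \<subseteq> U"
      using d e by (intro bexI[of _ "ball d (1 / real (Suc n))"]) (auto simp: B_def)
  qed
  ultimately show ?thesis
    using topological_basis_imp_subbasis by blast
qed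

lemma second_countable_topology_imp_separable:
  "separable_space (euclidean :: 'a::second_countable_topology topology)"
proof -
  obtain D :: "'a set" where D: "countable D" "\<And>X. open X \<Longrightarrow> X \<noteq> {} \<Longrightarrow> \<exists>d\<in>D. d \<in> X"
    using countable_dense_setE by metis
  have "closure D = UNIV"
    using D(2)[of "- closure D"] closure_subset[of D] by auto
  then show ?thesis
    unfolding separable_space_def using D(1) by auto
qed

text \<open>
  The dual of \<open>'e\<close> is the type \<open>'e \<Rightarrow>\<^sub>L real\<close>. In the definition of the weak topology,
  \<open>euclidean\<close> is the product topology on real-valued functions on the dual.
\<close>

definition weak_topology :: "'e::real_normed_vector topology" where
  "weak_topology = pullback_topology UNIV (\<lambda>e (\<phi> :: 'e \<Rightarrow>\<^sub>L real). blinfun_apply \<phi> e) euclidean"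

text \<open>For scalar-valued operators the strong operator topology is that of pointwise convergence.\<close>

definition weak_star_topology :: "('e::real_normed_vector \<Rightarrow>\<^sub>L real) topology" where
  "weak_star_topology = strong_operator_topology"

definition bidual_embedding :: "'e::real_normed_vector \<Rightarrow> (('e \<Rightarrow>\<^sub>L real) \<Rightarrow>\<^sub>L real)" where
  "bidual_embedding e = Blinfun (\<lambda>\<phi>. blinfun_apply \<phi> e)"

lemma bidual_embedding_apply: "blinfun_apply (bidual_embedding e) \<phi> = blinfun_apply \<phi> e"
  unfolding bidual_embedding_def
  by (simp add: bounded_linear_Blinfun_apply blinfun.bounded_linear_left)

definition reflexive_space :: "'e::real_normed_vector itself \<Rightarrow> bool" where
  "reflexive_space _ \<longleftrightarrow> surj (bidual_embedding :: 'e \<Rightarrow> _)"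

text \<open>Only the \<open>\<sigma>\<close>-algebra of the following measure is relevant (compare \<open>borel_def\<close>).\<close>

definition borel_of :: "'g topology \<Rightarrow> 'g measure" where
  "borel_of X = sigma (topspace X) {U. openin X U}"

definition lower_semicontinuous :: "'g topology \<Rightarrow> ('g \<Rightarrow> ereal) \<Rightarrow> bool" where
  "lower_semicontinuous X g \<longleftrightarrow> (\<forall>r. closedin X {x \<in> topspace X. g x \<le> r})"

definition normal_integrand :: "'w measure \<Rightarrow> 'g topology \<Rightarrow> ('w \<Rightarrow> 'g \<Rightarrow> ereal) \<Rightarrow> bool" where
  "normal_integrand M X g \<longleftrightarrow>
     (\<lambda>(\<omega>, x). g \<omega> x) \<in> borel_measurable (M \<Otimes>\<^sub>M borel_of X) \<and>
     (\<forall>\<omega>\<in>space M. lower_semicontinuous X (g \<omega>))"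

definition seq_weak_li :: "(nat \<Rightarrow> 'e::real_normed_vector \<Rightarrow> ereal) \<Rightarrow> 'e \<Rightarrow> ereal" where
  "seq_weak_li g e =
     Inf {liminf (\<lambda>n. g n (s n)) | s :: nat \<Rightarrow> 'e. limitin weak_topology s e sequentially}"

text \<open>The pairing is finite, so the differences below are never of the form \<open>\<infinity> - \<infinity>\<close>.\<close>

definition conjugate :: "('e::real_normed_vector \<Rightarrow> ereal) \<Rightarrow> ('e \<Rightarrow>\<^sub>L real) \<Rightarrow> ereal" where
  "conjugate h \<phi> = (SUP e. ereal (blinfun_apply \<phi> e) - h e)"

definition biconjugate :: "('e::real_normed_vector \<Rightarrow> ereal) \<Rightarrow> 'e \<Rightarrow> ereal" where
  "biconjugate h e = (SUP \<phi>. ereal (blinfun_apply \<phi> e) - conjugate h \<phi>)"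

definition inf_weakly_compact_every_slope :: "('e::real_normed_vector \<Rightarrow> ereal) \<Rightarrow> bool" where
  "inf_weakly_compact_every_slope h \<longleftrightarrow>
     (\<forall>(\<phi> :: 'e \<Rightarrow>\<^sub>L real) (r :: real).
        compactin weak_topology {e. h e - ereal (blinfun_apply \<phi> e) \<le> ereal r})"

definition quasi_inf_weakly_compact_every_slope ::
  "'w measure \<Rightarrow> (nat \<Rightarrow> 'w \<Rightarrow> 'e::real_normed_vector \<Rightarrow> ereal) \<Rightarrow> bool" where
  "quasi_inf_weakly_compact_every_slope M F \<longleftrightarrow>
     (\<forall>\<omega>\<in>space M. \<exists>h n0. inf_weakly_compact_every_slope h \<and> (\<forall>n\<ge>n0. \<forall>e. h e \<le> F n \<omega> e))"

end

theory Submission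
  imports Defs
begin

text \<open>
  Three ingredients make the conjugate \<open>f\<^sup>*\<close> and the biconjugate \<open>f\<^sup>*\<^sup>*\<close> normal. Lower
  semicontinuity is immediate, since both are suprema of functions that are affine and continuous in
  the weak-star, respectively the weak, topology. The work lies in joint measurability.

  The first ingredient is a formula in which no weakly convergent sequences occur. With
  \<open>B R\<close> the set of all \<open>e\<close> whose image in the bidual has norm at most \<open>R\<close>,
  \<open>f\<^sup>*(\<omega>, \<phi>) = sup R. limsup n. sup {\<phi> e - F n \<omega> e | e \<in> B R}\<close> (\<open>conjugate_seq_weak_li_eq\<close>).
  The inequality \<open>\<le>\<close> is the uniform boundedness principle for weakly convergent sequences. For
  \<open>\<ge>\<close>, almost maximal points are chosen along a subsequence of indices; under either assumption they
  lie in a set that is relatively compact for the weak topology and hence, \<open>E\<close> being separable, have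
  a weakly convergent subsequence (\<open>weakly_convergent_subsequence\<close>). Constant values at the
  remaining indices turn it into a full sequence without lowering the limit superior.

  The second ingredient (\<open>borel_measurable_SUP_pairing\<close>) shows that a function
  \<open>(\<omega>, y) \<mapsto> sup x. k y x - H \<omega> x\<close> is jointly measurable as soon as a countable family of sets \<open>U\<close>
  is fine enough to witness strict lower bounds of \<open>k y\<close> and the sets
  \<open>{\<omega>. \<exists>x\<in>U. H \<omega> x < q}\<close> are measurable: the superlevel sets are then countable unions of measurable
  rectangles. It applies to the suprema in the formula above, and again to
  \<open>f\<^sup>*\<^sup>*(\<omega>, e) = sup \<phi>. \<phi> e - f\<^sup>*(\<omega>, \<phi>)\<close>. In the second case the family comes from a countable base
  of the sequence space \<open>\<nat> \<Rightarrow> \<real>\<close>, because evaluation along a dense sequence embeds each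
  ball of the dual, with the weak-star topology, homeomorphically as a closed subset (\<open>dual_ball_coordinates\<close>).

  The third ingredient makes the sets \<open>{\<omega>. \<exists>x\<in>U. H \<omega> x < q}\<close> measurable. They are projections of
  product measurable sets along a Polish space, and such projections are measurable when the
  \<open>\<sigma>\<close>-finite measure is complete (\<open>measurable_projection\<close>). This is proved by a capacity
  argument: continuity of the outer measure along increasing sequences approximates the projection
  from inside.
\<close>

section \<open>Projections of countable intersections of unions of rectangles\<close>

lemma exists_dense_sequence:
  obtains d :: "nat \<Rightarrow> 'e::second_countable_topology" where "closure (range d) = UNIV"
proof -
  obtain T :: "'e set" where T: "countable T" "closure T = UNIV"
    using second_countable_topology_imp_separable by (auto simp: separable_space_def)
  then have "T \<noteq> {}" by auto
  then obtain d where "T = range (d :: nat \<Rightarrow> 'e)" using T(1) uncountable_def by blast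
  then show thesis using T(2) that by blast
qed

text \<open>
  Cantor's intersection theorem with total boundedness in place of shrinking diameters: points chosen
  from the sets form a relatively compact sequence, and any cluster point lies in all the sets.
\<close>
lemma nested_totally_bounded_Inter_nonempty:
  fixes L :: "nat \<Rightarrow> 'x::complete_space set"
  assumes cl: "\<And>n. closed (L n)" and dec: "decseq L" and ne: "\<And>n. L n \<noteq> {}"
    and tb: "\<And>n. \<exists>D. finite D \<and> L n \<subseteq> (\<Union>d\<in>D. cball d (1 / real (Suc n)))"
  shows "(\<Inter>n. L n) \<noteq> {}"
proof -
  obtain x where x: "\<And>n. x n \<in> L n" using ne by (meson ex_in_conv)
  have "compact (closure (range x))"
    unfolding compact_eq_totally_bounded
  proof (intro conjI allI impI)
    show "complete (closure (range x))" by (simp add: complete_eq_closed)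
    fix e :: real assume "e > 0"
    then obtain n where n: "1 / real (Suc n) < e" using nat_approx_posE by blast
    obtain D where D: "finite D" "L n \<subseteq> (\<Union>d\<in>D. cball d (1 / real (Suc n)))" using tb by blast
    let ?K = "D \<union> x ` {..<n}"
    have "range x \<subseteq> x ` {..<n} \<union> (\<Union>d\<in>D. cball d (1 / real (Suc n)))"
    proof
      fix z assume "z \<in> range x"
      then obtain m where z: "z = x m" by blast
      show "z \<in> x ` {..<n} \<union> (\<Union>d\<in>D. cball d (1 / real (Suc n)))"
      proof (cases "m < n")
        case False
        then have "x m \<in> L n" using x[of m] decseqD[OF dec, of n m] by auto
        then show ?thesis using D z by auto
      qed (auto simp: z)
    qed
    moreover have "closed (x ` {..<n} \<union> (\<Union>d\<in>D. cball d (1 / real (Suc n))))"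
      using D by (intro closed_Un finite_imp_closed closed_UN) auto
    ultimately have "closure (range x) \<subseteq> x ` {..<n} \<union> (\<Union>d\<in>D. cball d (1 / real (Suc n)))"
      by (simp add: closure_minimal)
    also have "\<dots> \<subseteq> (\<Union>z\<in>?K. ball z e)"
      using n \<open>e > 0\<close> by (fastforce simp: subset_eq)
    finally show "\<exists>k. finite k \<and> closure (range x) \<subseteq> (\<Union>z\<in>k. ball z e)"
      using D(1) by (intro exI[of _ ?K]) auto
  qed
  then have "seq_compact (closure (range x))" by (rule compact_imp_seq_compact)
  moreover have "\<forall>n. x n \<in> closure (range x)" by (simp add: closure_subset[THEN subsetD])
  ultimately obtain l r where l: "strict_mono (r :: nat \<Rightarrow> nat)" "(x \<circ> r) \<longlonglongrightarrow> l"
    unfolding seq_compact_def by metis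
  have "l \<in> L n" for n
  proof (rule Lim_in_closed_set[OF cl _ _ l(2)])
    show "eventually (\<lambda>k. (x \<circ> r) k \<in> L n) sequentially"
      unfolding eventually_sequentially
    proof (intro exI allI impI)
      fix k assume "n \<le> k"
      then have "n \<le> r k" using seq_suble[OF l(1), of k] by linarith
      then show "(x \<circ> r) k \<in> L n" using x[of "r k"] decseqD[OF dec] by auto
    qed
  qed simp
  then show ?thesis by blast
qed

text \<open>
  The union of countably many good inner approximations differs from a measurable hull of \<open>S\<close> of the
  same outer measure by a null set, and completeness absorbs the difference.
\<close>
lemma sets_if_approximable_from_inside:
  assumes "complete_measure M" and S: "S \<subseteq> space M" and fin: "outer_measure_of M S < \<infinity>"
    and approx: "\<And>a. a < outer_measure_of M S \<Longrightarrow> \<exists>L\<in>sets M. L \<subseteq> S \<and> a \<le> emeasure M L"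
  shows "S \<in> sets M"
proof -
  interpret complete_measure M by fact
  obtain H where H: "H \<in> sets M" "S \<subseteq> H" "outer_measure_of M S = emeasure M H"
    using outer_measure_of_attain[OF S] by blast
  obtain L where L: "L \<in> sets M" "L \<subseteq> S" "emeasure M H \<le> emeasure M L"
  proof (cases "outer_measure_of M S = 0")
    case True
    then show ?thesis using H by (intro that[of "{}"]) auto
  next
    case False
    then have "0 < outer_measure_of M S" by (simp add: zero_less_iff_neq_zero)
    then obtain u where u: "\<And>n::nat. u n < outer_measure_of M S" "u \<longlonglongrightarrow> outer_measure_of M S"
      using approx_from_below_dense_linorder by blast
    obtain L where L: "\<And>n. L n \<in> sets M \<and> L n \<subseteq> S \<and> u n \<le> emeasure M (L n)"
      using approx[OF u(1)] by metis
    have "u n \<le> emeasure M (\<Union>n. L n)" for n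
      using L[of n] L by (intro order_trans[OF conjunct2[OF conjunct2[OF L]]] emeasure_mono) auto
    then have "outer_measure_of M S \<le> emeasure M (\<Union>n. L n)"
      using u(2) by (meson LIMSEQ_le_const2)
    then show ?thesis using L H by (intro that[of "\<Union>n. L n"]) auto
  qed
  have "emeasure M L \<le> emeasure M H" using L H by (intro emeasure_mono) auto
  then have "emeasure M L \<noteq> \<infinity>" using fin H by (auto simp: top_unique)
  then have "emeasure M (H - L) = emeasure M H - emeasure M L"
    using L H by (intro emeasure_Diff) auto
  also have "\<dots> = 0" using L(3) fin H by (simp add: diff_eq_0_iff_ennreal)
  finally have "H - L \<in> null_sets M" using H L by auto
  then have "S - L \<in> sets M" using complete[of "S - L" "H - L"] H by blast
  then have "L \<union> (S - L) \<in> sets M" using L by blast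
  then show ?thesis using L(2) by (simp add: Un_absorb1)
qed

text \<open>
  The \<open>\<sigma>\<delta>\<close> sets over the rectangles with a measurable and a closed side. They are the
  sets to which the capacity argument applies directly.
\<close>
definition sigma_delta_rectangles :: "'w measure \<Rightarrow> ('w \<times> 'x::topological_space) set \<Rightarrow> bool" where
  "sigma_delta_rectangles M P \<longleftrightarrow>
     (\<exists>B C. (\<forall>n m. B n m \<in> sets M \<and> closed (C n m)) \<and> P = (\<Inter>n::nat. \<Union>m::nat. B n m \<times> C n m))"

lemma sigma_delta_rectanglesE:
  assumes "sigma_delta_rectangles M P"
  obtains B C where "\<And>n m. B n m \<in> sets M" "\<And>n m. closed (C n m)"
    "P = (\<Inter>n::nat. \<Union>m::nat. B n m \<times> C n m)"
proof -
  from assms obtain B C where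
    BC: "(\<forall>n m. B n m \<in> sets M \<and> closed (C n m)) \<and> P = (\<Inter>n::nat. \<Union>m::nat. B n m \<times> C n m)"
    unfolding sigma_delta_rectangles_def by (elim exE)
  show thesis by (rule that[of B C]) (use BC in auto)
qed

lemma sigma_delta_rectangles_familyE:
  assumes "\<And>k. sigma_delta_rectangles M (P k)"
  obtains B C where "\<And>k n m. B k n m \<in> sets M" "\<And>k n m. closed (C k n m)"
    "\<And>k. P k = (\<Inter>n::nat. \<Union>m::nat. B k n m \<times> C k n m)"
proof -
  define R where "R k B C \<longleftrightarrow> (\<forall>n m. B n m \<in> sets M \<and> closed (C n m)) \<and>
    P k = (\<Inter>n::nat. \<Union>m::nat. B n m \<times> C n m)" for k B C
  have "\<forall>k. \<exists>B C. R k B C" using assms unfolding sigma_delta_rectangles_def R_def by simp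
  then obtain B C where BC: "\<And>k. R k (B k) (C k)" by metis
  show thesis by (rule that[of B C]) (use BC in \<open>auto simp: R_def\<close>)
qed

lemma sigma_delta_rectanglesI:
  assumes "\<And>n m. B n m \<in> sets M" "\<And>n m. closed (C n m)"
    "P = (\<Inter>n::nat. \<Union>m::nat. B n m \<times> C n m)"
  shows "sigma_delta_rectangles M P"
  unfolding sigma_delta_rectangles_def
  by (rule exI[of _ B], rule exI[of _ C]) (intro conjI allI assms)

text \<open>
  The factor \<open>C\<close> is there for the induction on \<open>n\<close>: the second sides of the rectangles at stage
  \<open>n\<close> are moved into it.
\<close>
lemma sets_projection_finite_rectangles:
  assumes B: "\<And>n j. B n j \<in> sets M"
  shows "fst ` (space M \<times> C \<inter> (\<Inter>i<n::nat. \<Union>j\<le>k i::nat. B i j \<times> R i j)) \<in> sets M"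
proof (induction n arbitrary: C)
  case 0
  then show ?case by (cases "C = {}") (auto simp: fst_image_times)
next
  case (Suc n)
  have "fst ` (space M \<times> C \<inter> (\<Inter>i<Suc n. \<Union>j\<le>k i. B i j \<times> R i j)) =
    (\<Union>j\<le>k n. B n j \<inter> fst ` (space M \<times> (C \<inter> R n j) \<inter> (\<Inter>i<n. \<Union>j\<le>k i. B i j \<times> R i j)))"
    (is "?l = ?r")
  proof
    show "?l \<subseteq> ?r"
    proof
      fix w assume "w \<in> ?l"
      then obtain c where c: "(w, c) \<in> space M \<times> C \<inter> (\<Inter>i<Suc n. \<Union>j\<le>k i. B i j \<times> R i j)" by auto
      then obtain j where j: "j \<le> k n" "w \<in> B n j" "c \<in> R n j" by blast
      with c have "(w, c) \<in> space M \<times> (C \<inter> R n j) \<inter> (\<Inter>i<n. \<Union>j\<le>k i. B i j \<times> R i j)"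
        by auto
      then have "w \<in> fst ` (space M \<times> (C \<inter> R n j) \<inter> (\<Inter>i<n. \<Union>j\<le>k i. B i j \<times> R i j))"
        by (rule rev_image_eqI) simp
      then show "w \<in> ?r" using j by blast
    qed
    show "?r \<subseteq> ?l"
    proof
      fix w assume "w \<in> ?r"
      then obtain j c where "j \<le> k n" "w \<in> B n j"
        "(w, c) \<in> space M \<times> (C \<inter> R n j) \<inter> (\<Inter>i<n. \<Union>j\<le>k i. B i j \<times> R i j)" by auto
      then have "(w, c) \<in> space M \<times> C \<inter> (\<Inter>i<Suc n. \<Union>j\<le>k i. B i j \<times> R i j)"
        by (auto simp: lessThan_Suc)
      then show "w \<in> ?l" by (rule rev_image_eqI) simp
    qed
  qed
  also have "\<dots> \<in> sets M" using Suc B by auto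
  finally show ?case .
qed

text \<open>
  The capacity argument. Write \<open>P\<close> as the intersection of the increasing unions of \<open>U n k\<close> over \<open>k\<close>,
  each \<open>U n k\<close> a finite union of rectangles. By continuity of the outer measure along increasing
  sequences, indices \<open>k n\<close> can be chosen one after the other such that the projection of
  \<open>P \<inter> U 0 (k 0) \<inter> \<dots> \<inter> U n (k n)\<close> always keeps outer measure greater than \<open>a\<close>. The projections
  of \<open>U 0 (k 0) \<inter> \<dots> \<inter> U n (k n)\<close> are measurable and decreasing in \<open>n\<close>, so their intersection
  still has measure at least \<open>a\<close>. It lies in the projection of \<open>P\<close>, because over a fixed point
  the sections have a common point by the compactness in \<open>nested_totally_bounded_Inter_nonempty\<close>.
\<close>
lemma sets_projection_sigma_delta_finite:
  fixes P :: "('w \<times> 'x::{complete_space, second_countable_topology}) set"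
  assumes M: "complete_measure M" and P: "sigma_delta_rectangles M P"
    and D: "D \<in> sets M" "emeasure M D < \<infinity>" "fst ` P \<subseteq> D"
  shows "fst ` P \<in> sets M"
proof (rule sets_if_approximable_from_inside[OF M])
  note Dsp = sets.sets_into_space[OF D(1)]
  show "fst ` P \<subseteq> space M" using D Dsp by auto
  have "outer_measure_of M (fst ` P) \<le> outer_measure_of M D" by (rule outer_measure_of_mono[OF D(3)])
  with D show "outer_measure_of M (fst ` P) < \<infinity>" by auto
  fix a assume a: "a < outer_measure_of M (fst ` P)"
  obtain B0 C0 where B0: "\<And>n m. B0 n m \<in> sets M" and C0: "\<And>n m. closed (C0 n m)"
    and P_eq: "P = (\<Inter>n::nat. \<Union>m::nat. B0 n m \<times> C0 n m)"
    by (rule sigma_delta_rectanglesE[OF P]) (rule that; assumption)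
  obtain d :: "nat \<Rightarrow> 'x" where "closure (range d) = UNIV" by (rule exists_dense_sequence)
  then have d: "\<exists>i. dist (d i) x < e" if "e > 0" for x e
    using closure_approachable[of x "range d"] that by auto
  \<comment> \<open>Intersecting the rectangles of level \<open>n\<close> with small balls does not change their union, but it
    makes finite unions of them totally bounded up to the scale \<open>1 / Suc n\<close>.\<close>
  define B where "B n j = B0 n (fst (prod_decode j))" for n j
  define C where "C n j = C0 n (fst (prod_decode j)) \<inter> cball (d (snd (prod_decode j))) (1 / real (Suc n))" for n j
  have B: "B n j \<in> sets M" and C: "closed (C n j)" for n j
    using B0 C0 by (auto simp: B_def C_def)
  have refine: "(\<Union>j. B n j \<times> C n j) = (\<Union>m. B0 n m \<times> C0 n m)" for n
  proof
    show "(\<Union>j. B n j \<times> C n j) \<subseteq> (\<Union>m. B0 n m \<times> C0 n m)" by (auto simp: B_def C_def)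
    show "(\<Union>m. B0 n m \<times> C0 n m) \<subseteq> (\<Union>j. B n j \<times> C n j)"
    proof
      fix z assume "z \<in> (\<Union>m. B0 n m \<times> C0 n m)"
      then obtain m w x where z: "z = (w, x)" "w \<in> B0 n m" "x \<in> C0 n m" by auto
      obtain i where "dist (d i) x < 1 / real (Suc n)" using d[of "1 / real (Suc n)" x] by auto
      then show "z \<in> (\<Union>j. B n j \<times> C n j)"
        using z by (intro UN_I[of "prod_encode (m, i)"]) (auto simp: B_def C_def)
    qed
  qed
  define U where "U n k = (\<Union>j\<le>k. B n j \<times> C n j)" for n k
  have P_sub: "P \<subseteq> (\<Union>k. U n k)" for n
    unfolding P_eq U_def using refine[of n] by blast
  have "\<exists>Q. \<forall>n. (a < outer_measure_of M (fst ` Q n) \<and> Q n \<subseteq> P) \<and> (\<exists>k. Q (Suc n) = Q n \<inter> U n k)"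
  proof (rule dependent_nat_choice)
    show "\<exists>x. a < outer_measure_of M (fst ` x) \<and> x \<subseteq> P" using a by blast
  next
    fix x n assume x: "a < outer_measure_of M (fst ` x) \<and> x \<subseteq> P"
    have sp: "fst ` (x \<inter> U n k) \<subseteq> space M" for k using x D(3) Dsp by blast
    have inc: "incseq (\<lambda>k. fst ` (x \<inter> U n k))"
      by (rule incseq_SucI) (auto simp: U_def le_Suc_eq intro!: imageI)
    have "fst ` x = (\<Union>k. fst ` (x \<inter> U n k))" using x P_sub[of n] by blast
    then have "a < (SUP k. outer_measure_of M (fst ` (x \<inter> U n k)))"
      using x SUP_outer_measure_of_incseq[OF sp inc] by simp
    then obtain k where "a < outer_measure_of M (fst ` (x \<inter> U n k))" by (auto simp: less_SUP_iff)
    then show "\<exists>y. (a < outer_measure_of M (fst ` y) \<and> y \<subseteq> P) \<and> (\<exists>k. y = x \<inter> U n k)"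
      using x by (intro exI[of _ "x \<inter> U n k"]) auto
  qed
  then obtain Q k where Q: "\<And>n. a < outer_measure_of M (fst ` Q n)" "\<And>n. Q n \<subseteq> P"
      "\<And>n. Q (Suc n) = Q n \<inter> U n (k n)"
    by metis
  define V where "V n = space M \<times> UNIV \<inter> (\<Inter>i<n. U i (k i))" for n
  have V_sets: "fst ` V n \<in> sets M" for n
    unfolding V_def U_def by (rule sets_projection_finite_rectangles[OF B])
  have V_dec: "V (Suc n) \<subseteq> V n" for n by (auto simp: V_def)
  have Q_V: "Q n \<subseteq> V n" for n
  proof (induction n)
    case 0 show ?case using Q(2)[of 0] D(3) Dsp by (force simp: V_def)
  next
    case (Suc n) then show ?case using Q(3)[of n] by (auto simp: V_def lessThan_Suc)
  qed
  \<comment> \<open>\<open>V 0\<close> projects to the whole space; intersecting with \<open>D\<close> gives finite measures, as continuity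
    from above requires.\<close>
  define L where "L = (\<Inter>n. D \<inter> fst ` V n)"
  have L_sets: "L \<in> sets M" unfolding L_def using V_sets D by auto
  have "a \<le> emeasure M (D \<inter> fst ` V n)" for n
  proof -
    have "outer_measure_of M (fst ` Q n) \<le> outer_measure_of M (D \<inter> fst ` V n)"
      using Q_V[of n] Q(2)[of n] D(3) by (intro outer_measure_of_mono) blast
    also have "\<dots> = emeasure M (D \<inter> fst ` V n)"
      using V_sets D by (intro outer_measure_of_eq sets.Int)
    finally show ?thesis using Q(1)[of n] by simp
  qed
  moreover have "(INF n. emeasure M (D \<inter> fst ` V n)) = emeasure M L"
    unfolding L_def
  proof (rule INF_emeasure_decseq)
    show "range (\<lambda>n. D \<inter> fst ` V n) \<subseteq> sets M" using V_sets D by auto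
    show "decseq (\<lambda>n. D \<inter> fst ` V n)"
      using V_dec by (intro decseq_SucI) blast
    show "emeasure M (D \<inter> fst ` V n) \<noteq> \<infinity>" for n
      using D emeasure_mono[of "D \<inter> fst ` V n" D M] by (auto simp: top_unique)
  qed
  ultimately have a_L: "a \<le> emeasure M L" by (metis INF_greatest)
  have "L \<subseteq> fst ` P"
  proof
    fix w assume w: "w \<in> L"
    \<comment> \<open>The shift by one makes the rectangles of level \<open>n\<close>, with their balls of radius
      \<open>1 / Suc n\<close>, contribute to the section \<open>S n\<close>.\<close>
    define S where "S n = {x. (w, x) \<in> V (Suc n)}" for n
    have "(\<Inter>n. S n) \<noteq> {}"
    proof (rule nested_totally_bounded_Inter_nonempty)
      have cl: "closed {x. (w, x) \<in> U i m}" for i m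
      proof -
        have "{x. (w, x) \<in> U i m} = (\<Union>j\<in>{j. j \<le> m \<and> w \<in> B i j}. C i j)" by (auto simp: U_def)
        then show ?thesis using C by (auto intro!: closed_UN)
      qed
      have "S n = {x. w \<in> space M} \<inter> (\<Inter>i<Suc n. {x. (w, x) \<in> U i (k i)})" for n
        by (auto simp: S_def V_def)
      then show "closed (S n)" for n using cl by (simp add: closed_Int closed_INT)
      show "decseq S" using V_dec by (intro decseq_SucI) (auto simp: S_def)
      show "S n \<noteq> {}" for n using w by (force simp: L_def S_def)
      show "\<exists>D. finite D \<and> S n \<subseteq> (\<Union>d\<in>D. cball d (1 / real (Suc n)))" for n
        by (rule exI[of _ "(\<lambda>j. d (snd (prod_decode j))) ` {..k n}"])
          (fastforce simp: S_def V_def U_def C_def)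
    qed
    then obtain x where x: "\<And>n. x \<in> S n" by blast
    have "(w, x) \<in> P"
      unfolding P_eq refine[symmetric] using x by (fastforce simp: S_def V_def U_def)
    then show "w \<in> fst ` P" by force
  qed
  then show "\<exists>L\<in>sets M. L \<subseteq> fst ` P \<and> a \<le> emeasure M L" using L_sets a_L by blast
qed

lemma sets_projection_sigma_delta:
  fixes P :: "('w \<times> 'x::{complete_space, second_countable_topology}) set"
  assumes fin: "sigma_finite_measure M" and M: "complete_measure M" and P: "sigma_delta_rectangles M P"
  shows "fst ` P \<in> sets M"
proof -
  interpret sigma_finite_measure M by fact
  obtain A :: "nat \<Rightarrow> 'w set" where A: "range A \<subseteq> sets M" "(\<Union>i. A i) = space M" "\<And>i. emeasure M (A i) \<noteq> \<infinity>"
    using sigma_finite by blast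
  obtain B C where B: "\<And>n m. B n m \<in> sets M" and C: "\<And>n m. closed (C n m)"
    and P_eq: "P = (\<Inter>n::nat. \<Union>m::nat. B n m \<times> C n m)"
    by (rule sigma_delta_rectanglesE[OF P]) (rule that; assumption)
  have "fst ` (P \<inter> A i \<times> UNIV) \<in> sets M" for i
  proof (rule sets_projection_sigma_delta_finite[OF M])
    have "P \<inter> A i \<times> UNIV = (\<Inter>n. \<Union>m. (B n m \<inter> A i) \<times> C n m)" unfolding P_eq by auto
    then show "sigma_delta_rectangles M (P \<inter> A i \<times> UNIV)"
      using A B C by (intro sigma_delta_rectanglesI[where B="\<lambda>n m. B n m \<inter> A i" and C=C]) auto
    show "A i \<in> sets M" "emeasure M (A i) < \<infinity>" using A by (auto simp: less_top)
  qed auto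
  moreover have "fst ` P = (\<Union>i. fst ` (P \<inter> A i \<times> UNIV))"
  proof -
    have "P \<subseteq> space M \<times> UNIV" unfolding P_eq using B[THEN sets.sets_into_space] by blast
    show ?thesis
    proof (intro subset_antisym subsetI)
      fix w assume "w \<in> fst ` P"
      then obtain x where x: "(w, x) \<in> P" by auto
      with \<open>P \<subseteq> space M \<times> UNIV\<close> A(2) obtain i where "w \<in> A i" by blast
      with x have "(w, x) \<in> P \<inter> A i \<times> UNIV" by simp
      then have "w \<in> fst ` (P \<inter> A i \<times> UNIV)" by (rule rev_image_eqI) simp
      then show "w \<in> (\<Union>i. fst ` (P \<inter> A i \<times> UNIV))" by blast
    qed blast
  qed
  ultimately show ?thesis by auto
qed

section \<open>The measurable projection theorem\<close>
lemma sigma_delta_rectangles_vimage: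
  fixes g :: "'y::topological_space \<Rightarrow> 'x::topological_space"
  assumes P: "sigma_delta_rectangles M P" and g: "continuous_on UNIV g"
  shows "sigma_delta_rectangles M {(w, y). (w, g y) \<in> P}"
proof -
  obtain B C where B: "\<And>n m. B n m \<in> sets M" and C: "\<And>n m. closed (C n m)"
    and P_eq: "P = (\<Inter>n::nat. \<Union>m::nat. B n m \<times> C n m)"
    by (rule sigma_delta_rectanglesE[OF P]) (rule that; assumption)
  have "{(w, y). (w, g y) \<in> P} = (\<Inter>n. \<Union>m. B n m \<times> (g -` C n m))" unfolding P_eq by auto
  moreover have "closed (g -` C n m)" for n m using C g by (simp add: closed_vimage)
  ultimately show ?thesis using B by (intro sigma_delta_rectanglesI[where B=B and C="\<lambda>n m. g -` C n m"]) auto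
qed

lemma sigma_delta_rectangles_INT:
  assumes P: "\<And>k::nat. sigma_delta_rectangles M (P k)"
  shows "sigma_delta_rectangles M (\<Inter>k. P k)"
proof -
  obtain B C where B: "\<And>k n m. B k n m \<in> sets M" and C: "\<And>k n m. closed (C k n m)"
    and P_eq: "\<And>k. P k = (\<Inter>n::nat. \<Union>m::nat. B k n m \<times> C k n m)"
    by (rule sigma_delta_rectangles_familyE[of M P, OF P]) (rule that; assumption)
  define B' where "B' n m = B (fst (prod_decode n)) (snd (prod_decode n)) m" for n m
  define C' where "C' n m = C (fst (prod_decode n)) (snd (prod_decode n)) m" for n m
  define X where "X p = (\<Union>m. B (fst p) (snd p) m \<times> C (fst p) (snd p) m)" for p
  have "(\<Inter>n. \<Union>m. B' n m \<times> C' n m) = \<Inter>(X ` range prod_decode)"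
    by (simp add: image_image X_def B'_def C'_def)
  also have "\<dots> = (\<Inter>p. \<Union>m. B (fst p) (snd p) m \<times> C (fst p) (snd p) m)"
    by (simp add: surj_prod_decode X_def)
  also have "\<dots> = (\<Inter>k. P k)" unfolding P_eq by auto
  finally show ?thesis
    using B C by (intro sigma_delta_rectanglesI[where B=B' and C=C']) (simp_all add: B'_def C'_def)
qed

text \<open>
  A union of \<open>\<sigma>\<delta>\<close> sets need not be \<open>\<sigma>\<delta>\<close>. It is when the sets live over disjoint closed sets
  \<open>F k\<close>, for then union and intersection may be exchanged: a point over \<open>F k\<close> can only be covered
  by rectangles that belong to \<open>P k\<close>.
\<close>
lemma sigma_delta_rectangles_disjoint_UN:
  assumes P: "\<And>k::nat. sigma_delta_rectangles M (P k)"
    and F: "\<And>k. closed (F k)" and disj: "\<And>j k. j \<noteq> k \<Longrightarrow> F j \<inter> F k = {}"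
  shows "sigma_delta_rectangles M (\<Union>k. P k \<inter> UNIV \<times> F k)"
proof -
  obtain B C where B: "\<And>k n m. B k n m \<in> sets M" and C: "\<And>k n m. closed (C k n m)"
    and P_eq: "\<And>k. P k = (\<Inter>n::nat. \<Union>m::nat. B k n m \<times> C k n m)"
    by (rule sigma_delta_rectangles_familyE[of M P, OF P]) (rule that; assumption)
  define B' where "B' n j = B (fst (prod_decode j)) n (snd (prod_decode j))" for n j
  define C' where "C' n j = C (fst (prod_decode j)) n (snd (prod_decode j)) \<inter> F (fst (prod_decode j))" for n j
  have "(\<Union>j. B' n j \<times> C' n j) = (\<Union>p. B (fst p) n (snd p) \<times> (C (fst p) n (snd p) \<inter> F (fst p)))" for n
  proof -
    define X where "X p = B (fst p) n (snd p) \<times> (C (fst p) n (snd p) \<inter> F (fst p))" for p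
    have "(\<Union>j. B' n j \<times> C' n j) = \<Union>(X ` range prod_decode)"
      by (simp add: image_image X_def B'_def C'_def)
    then show ?thesis by (simp add: surj_prod_decode X_def)
  qed
  then have "(\<Inter>n. \<Union>j. B' n j \<times> C' n j) = (\<Inter>n. \<Union>k m. B k n m \<times> (C k n m \<inter> F k))"
    by auto
  also have "\<dots> = (\<Union>k. P k \<inter> UNIV \<times> F k)" (is "?l = ?r")
  proof
    show "?r \<subseteq> ?l" unfolding P_eq by fastforce
    show "?l \<subseteq> ?r"
    proof
      fix z assume z: "z \<in> ?l"
      then obtain k where k: "snd z \<in> F k" by fastforce
      have "z \<in> (\<Union>m. B k n m \<times> C k n m)" for n
      proof -
        from z obtain k' m where "z \<in> B k' n m \<times> (C k' n m \<inter> F k')" by blast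
        moreover from this have "k' = k" using disj[of k' k] k by (metis IntI SigmaE empty_iff snd_conv IntD2)
        ultimately show ?thesis by auto
      qed
      then show "z \<in> ?r" unfolding P_eq using k by (cases z) auto
    qed
  qed
  finally show ?thesis
    using B C F by (intro sigma_delta_rectanglesI[where B=B' and C=C']) (auto simp: B'_def C'_def)
qed

text \<open>
  An auxiliary factor \<open>\<nat> \<Rightarrow> \<real>\<close> turns the \<open>\<sigma>\<delta>\<close> sets into a class that is closed under
  countable unions and intersections and thus contains all product measurable sets.
  It plays the part of the Baire space in the description of analytic sets: it contains countably
  many disjoint closed copies of itself and can be mapped onto its own countable power.
\<close>
definition projected_sigma_delta :: "'w measure \<Rightarrow> ('w \<times> 'x::topological_space) set \<Rightarrow> bool" where
  "projected_sigma_delta M A \<longleftrightarrow>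
     (\<exists>P :: ('w \<times> 'x \<times> (nat \<Rightarrow> real)) set.
        sigma_delta_rectangles M P \<and> A = {(w, x). \<exists>y. (w, x, y) \<in> P})"

lemma projected_sigma_delta_rectangles:
  assumes B: "\<And>m. B m \<in> sets M" and C: "\<And>m. closed (C m)"
  shows "projected_sigma_delta M (\<Union>m::nat. B m \<times> C m)"
proof -
  have "sigma_delta_rectangles M (\<Union>m. B m \<times> (C m \<times> (UNIV :: (nat \<Rightarrow> real) set)))"
    using B C
    by (intro sigma_delta_rectanglesI[where B="\<lambda>n. B" and C="\<lambda>n m. C m \<times> UNIV"]) (auto intro: closed_Times)
  then show ?thesis unfolding projected_sigma_delta_def
    by (intro exI[of _ "\<Union>m. B m \<times> (C m \<times> UNIV)"]) auto
qed

lemma projected_sigma_delta_familyE: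
  fixes A :: "'k \<Rightarrow> ('w \<times> 'x::topological_space) set"
  assumes "\<And>k. projected_sigma_delta M (A k)"
  obtains P where "\<And>k. sigma_delta_rectangles M (P k)"
    "\<And>k. A k = {(w, x). \<exists>y::nat \<Rightarrow> real. (w, x, y) \<in> P k}"
proof -
  define R where "R k P \<longleftrightarrow> sigma_delta_rectangles M P \<and>
    A k = {(w, x). \<exists>y::nat \<Rightarrow> real. (w, x, y) \<in> P}" for k P
  have "\<forall>k. \<exists>P. R k P" using assms unfolding projected_sigma_delta_def R_def by simp
  then obtain P where "\<And>k. R k (P k)" by metis
  then show thesis by (intro that[of P]) (simp_all add: R_def)
qed

lemma projected_sigma_delta_INT:
  assumes "\<And>k::nat. projected_sigma_delta M (A k)"
  shows "projected_sigma_delta M (\<Inter>k. A k)"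
proof -
  obtain P where P: "\<And>k. sigma_delta_rectangles M (P k)"
    and A: "\<And>k. A k = {(w, x). \<exists>y::nat \<Rightarrow> real. (w, x, y) \<in> P k}"
    by (rule projected_sigma_delta_familyE[of M A, OF assms]) (rule that; assumption)
  \<comment> \<open>The maps \<open>g k\<close> read off countably many independent sequences from a single one, so that one
    auxiliary point can witness membership in every \<open>A k\<close>.\<close>
  define g where "g k = (\<lambda>(x::'b, y::nat \<Rightarrow> real). (x, \<lambda>j. y (prod_encode (k, j))))" for k
  have "continuous_on UNIV (g k)" for k
    unfolding g_def case_prod_unfold
    by (intro continuous_intros continuous_on_coordinatewise_then_product
      continuous_on_product_then_coordinatewise)
  then have "sigma_delta_rectangles M (\<Inter>k. {(w, z). (w, g k z) \<in> P k})"
    by (intro sigma_delta_rectangles_INT sigma_delta_rectangles_vimage P)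
  moreover have "(\<Inter>k. A k) = {(w, x). \<exists>y. (w, x, y) \<in> (\<Inter>k. {(w, z). (w, g k z) \<in> P k})}"
  proof (intro set_eqI iffI; clarify)
    fix w x assume "(w, x) \<in> (\<Inter>k. A k)"
    then obtain y where y: "\<And>k. (w, x, y k) \<in> P k" unfolding A by (auto; metis)
    have "(\<lambda>j. (\<lambda>n. y (fst (prod_decode n)) (snd (prod_decode n))) (prod_encode (k, j))) = y k" for k
      by simp
    then show "\<exists>ya. (w, x, ya) \<in> (\<Inter>k. {(w, z). (w, g k z) \<in> P k})"
      using y by (intro exI[of _ "\<lambda>n. y (fst (prod_decode n)) (snd (prod_decode n))"]) (simp add: g_def)
  qed (auto simp: A g_def)
  ultimately show ?thesis unfolding projected_sigma_delta_def by blast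
qed

lemma projected_sigma_delta_UN:
  assumes "\<And>k::nat. projected_sigma_delta M (A k)"
  shows "projected_sigma_delta M (\<Union>k. A k)"
proof -
  obtain P where P: "\<And>k. sigma_delta_rectangles M (P k)"
    and A: "\<And>k. A k = {(w, x). \<exists>y::nat \<Rightarrow> real. (w, x, y) \<in> P k}"
    by (rule projected_sigma_delta_familyE[of M A, OF assms]) (rule that; assumption)
  \<comment> \<open>The first entry of the auxiliary sequence names the member of the union, its tail is the witness.\<close>
  define g where "g = (\<lambda>(x::'b, y::nat \<Rightarrow> real). (x, \<lambda>j. y (Suc j)))"
  define F where "F k = {z :: 'b \<times> (nat \<Rightarrow> real). snd z 0 = real k}" for k :: nat
  have "continuous_on UNIV g"
    unfolding g_def case_prod_unfold
    by (intro continuous_intros continuous_on_coordinatewise_then_product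
      continuous_on_product_then_coordinatewise)
  moreover have "closed (F k)" for k
    unfolding F_def by (intro closed_Collect_eq continuous_intros continuous_on_product_then_coordinatewise)
  ultimately have "sigma_delta_rectangles M (\<Union>k. {(w, z). (w, g z) \<in> P k} \<inter> UNIV \<times> F k)"
    by (intro sigma_delta_rectangles_disjoint_UN sigma_delta_rectangles_vimage P) (auto simp: F_def)
  moreover have "(\<Union>k. A k) = {(w, x). \<exists>y. (w, x, y) \<in> (\<Union>k. {(w, z). (w, g z) \<in> P k} \<inter> UNIV \<times> F k)}"
  proof (intro set_eqI iffI; clarify)
    fix w x k assume "(w, x) \<in> A k"
    then obtain y where y: "(w, x, y) \<in> P k" unfolding A by auto
    then show "\<exists>y. (w, x, y) \<in> (\<Union>k. {(w, z). (w, g z) \<in> P k} \<inter> UNIV \<times> F k)"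
      by (intro exI[of _ "case_nat (real k) y"]) (auto simp: g_def F_def)
  qed (auto simp: A g_def)
  ultimately show ?thesis unfolding projected_sigma_delta_def by blast
qed

text \<open>
  The sets which belong to the class together with their complements form a \<open>\<sigma>\<close>-algebra. It contains
  the rectangles with a closed side because open sets in a metric space are \<open>F\<^sub>\<sigma>\<close>.
\<close>
lemma projected_sigma_delta_if_measurable:
  fixes A :: "('w \<times> 'x::metric_space) set"
  assumes "A \<in> sets (M \<Otimes>\<^sub>M borel)"
  shows "projected_sigma_delta M A"
proof -
  let ?G = "{a \<times> b | a b. a \<in> sets M \<and> b \<in> {S::'x set. closed S}}"
  have "sets (M \<Otimes>\<^sub>M (borel :: 'x measure)) = sigma_sets (space M \<times> UNIV) ?G"
  proof -
    have "sets (M \<Otimes>\<^sub>M (borel :: 'x measure)) = sets (sigma (space M \<times> space (borel :: 'x measure)) ?G)"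
      by (rule sets_pair_eq[where Ca="{space M}" and Cb="{UNIV}"])
        (auto simp: sets.sigma_sets_eq sets.space_closed borel_eq_closed dest: sets.sets_into_space)
    then show ?thesis by (subst (asm) sets_measure_of) (auto dest: sets.sets_into_space)
  qed
  with assms have "A \<in> sigma_sets (space M \<times> UNIV) ?G" by simp
  then have "projected_sigma_delta M A \<and> projected_sigma_delta M (space M \<times> UNIV - A)"
  proof induction
    case (Basic R)
    then obtain a b where ab: "R = a \<times> b" "a \<in> sets M" "closed b" by auto
    have "projected_sigma_delta M (\<Union>m::nat. a \<times> b)"
      using ab by (intro projected_sigma_delta_rectangles) auto
    moreover have "fsigma_in euclidean (- b)"
      using ab by (intro open_imp_fsigma_in metrizable_space_euclidean) auto
    then obtain C :: "nat \<Rightarrow> 'x set" where C: "\<And>n. closed (C n)" "(\<Union>n. C n) = - b"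
      unfolding fsigma_in_ascending by auto
    have "projected_sigma_delta M
        (\<Union>m. (if m = 0 then space M - a else space M) \<times> (if m = 0 then UNIV else C (m - 1)))"
      using ab C by (intro projected_sigma_delta_rectangles) auto
    moreover have "(\<Union>m. (if m = 0 then space M - a else space M) \<times> (if m = 0 then UNIV else C (m - 1)))
        = (space M - a) \<times> UNIV \<union> space M \<times> (\<Union>n. C n)" (is "?l = ?r")
    proof
      show "?l \<subseteq> ?r" by (auto split: if_splits)
      show "?r \<subseteq> ?l"
      proof
        fix z assume "z \<in> ?r"
        then consider "z \<in> (space M - a) \<times> UNIV" | n where "z \<in> space M \<times> C n" by blast
        then show "z \<in> ?l"
        proof cases
          case 1 then show ?thesis by (intro UN_I[of 0]) auto
        next
          case (2 n) then show ?thesis by (intro UN_I[of "Suc n"]) auto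
        qed
      qed
    qed
    moreover have "(space M - a) \<times> UNIV \<union> space M \<times> (\<Union>n. C n) = space M \<times> UNIV - R"
      using ab C(2) by auto
    ultimately show ?case using ab by simp
  next
    case Empty
    have "projected_sigma_delta M (\<Union>m::nat. {} \<times> (UNIV :: 'x set))"
      "projected_sigma_delta M (\<Union>m::nat. space M \<times> (UNIV :: 'x set))"
      by (intro projected_sigma_delta_rectangles; simp)+
    then show ?case by simp
  next
    case (Compl a)
    have "A \<subseteq> space M \<times> UNIV" if "A \<in> sigma_sets (space M \<times> UNIV) ?G" for A :: "('w \<times> 'x) set"
      using that by (rule sigma_sets_into_sp[rotated]) (auto dest: sets.sets_into_space)
    then show ?case using Compl by (simp add: double_diff)
  next
    case (Union a)
    have "projected_sigma_delta M (\<Inter>i. space M \<times> UNIV - a i)"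
      using Union by (intro projected_sigma_delta_INT) blast
    moreover have "(\<Inter>i. space M \<times> UNIV - a i) = space M \<times> UNIV - (\<Union>i. a i)" by auto
    ultimately show ?case using Union by (simp add: projected_sigma_delta_UN)
  qed
  then show ?thesis by simp
qed

theorem measurable_projection:
  fixes A :: "('w \<times> 'x::{complete_space, second_countable_topology}) set"
  assumes "sigma_finite_measure M" "complete_measure M" "A \<in> sets (M \<Otimes>\<^sub>M borel)"
  shows "fst ` A \<in> sets M"
proof -
  obtain P :: "('w \<times> 'x \<times> (nat \<Rightarrow> real)) set"
    where P: "sigma_delta_rectangles M P" "A = {(w, x). \<exists>y. (w, x, y) \<in> P}"
    using projected_sigma_delta_if_measurable[OF assms(3)] unfolding projected_sigma_delta_def by blast
  have "fst ` A = fst ` P" unfolding P(2) by force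
  then show ?thesis using sets_projection_sigma_delta[OF assms(1,2) P(1)] by simp
qed

section \<open>Suprema of pairings\<close>
lemma space_borel_of [simp]: "space (borel_of T) = topspace T"
  unfolding borel_of_def by (rule space_measure_of) (auto dest: openin_subset)

lemma sets_borel_of: "sets (borel_of T) = sigma_sets (topspace T) {U. openin T U}"
  unfolding borel_of_def by (rule sets_measure_of) (auto dest: openin_subset)

lemma closedin_sets_borel_of:
  assumes "closedin T S" shows "S \<in> sets (borel_of T)"
proof -
  have "topspace T - (topspace T - S) \<in> sets (borel_of T)"
    using assms unfolding sets_borel_of by (intro sigma_sets.Compl sigma_sets.Basic) (auto simp: closedin_def)
  then show ?thesis using closedin_subset[OF assms] by (simp add: double_diff)
qed

text \<open>
  These equivalences hold even for infinite values. They replace estimates that would otherwise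
  need case distinctions on \<open>\<infinity>\<close>.
\<close>
lemma ereal_minus_le_swap: "ereal a - b \<le> c \<longleftrightarrow> ereal a - c \<le> b"
  by (cases b; cases c) auto

lemma ereal_less_minus_swap: "c < ereal a - b \<longleftrightarrow> b < ereal a - c"
  using ereal_minus_le_swap[of a b c] by (simp flip: not_le)

lemma closedin_ge_ereal:
  assumes "continuous_map T euclidean k"
  shows "closedin T {y \<in> topspace T. c \<le> ereal (k y - q)}"
proof (cases c)
  case (real r)
  then have "{y \<in> topspace T. c \<le> ereal (k y - q)} = {y \<in> topspace T. k y \<in> {r + q..}}" by auto
  then show ?thesis using closedin_continuous_map_preimage[OF assms, of "{r + q..}"] by simp
qed auto

lemma lower_semicontinuous_SUP_affine:
  assumes "\<And>x. continuous_map T euclidean (\<lambda>y. k y x)"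
  shows "lower_semicontinuous T (\<lambda>y. SUP x. ereal (k y x) - h x)"
  unfolding lower_semicontinuous_def
proof
  fix r
  have cl: "closedin T {y \<in> topspace T. ereal (k y x) - h x \<le> r}" for x
  proof -
    have neg: "continuous_map T euclidean (\<lambda>y. - k y x)"
      using assms by (rule continuous_map_minus)
    have *: "closedin T {y \<in> topspace T. - c \<le> ereal (- k y x - 0)}" for c
      by (rule closedin_ge_ereal[OF neg])
    show ?thesis
    proof (cases "h x")
      case (real b)
      then have "(ereal (k y x) - h x \<le> r) = (- (r + ereal b) \<le> ereal (- k y x - 0))" for y
        by (cases r) auto
      then show ?thesis using * by presburger
    qed (cases r; auto)+
  qed
  have "{y \<in> topspace T. (SUP x. ereal (k y x) - h x) \<le> r} =
      (\<Inter>x. {y \<in> topspace T. ereal (k y x) - h x \<le> r})"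
    by (auto simp: SUP_le_iff)
  then show "closedin T {y \<in> topspace T. (SUP x. ereal (k y x) - h x) \<le> r}"
    using cl by auto
qed

text \<open>
  A value \<open>k y x - H \<omega> x > c\<close> can be certified by a rational \<open>q\<close> and a set \<open>U \<in> \<U>\<close>: some point of
  \<open>U\<close>, possibly different from \<open>x\<close>, has \<open>H \<omega> < q\<close>, while \<open>k y - q \<ge> c\<close> on all of \<open>U\<close>. The
  certificate splits into a condition on \<open>\<omega>\<close> and a closed condition on \<open>y\<close>, so that the superlevel
  set is a countable union of rectangles.
\<close>
lemma borel_measurable_SUP_pairing:
  fixes H :: "'w \<Rightarrow> 'x \<Rightarrow> ereal" and k :: "'y \<Rightarrow> 'x \<Rightarrow> real"
  assumes cnt: "countable \<U>"
    and H: "\<And>U q. U \<in> \<U> \<Longrightarrow> {\<omega> \<in> space M. \<exists>x\<in>U. H \<omega> x < ereal q} \<in> sets M"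
    and k: "\<And>x. continuous_map T euclidean (\<lambda>y. k y x)"
    and loc: "\<And>x y a. x \<in> \<Union>\<U> \<Longrightarrow> y \<in> topspace T \<Longrightarrow> a < k y x \<Longrightarrow> \<exists>U\<in>\<U>. x \<in> U \<and> (\<forall>x'\<in>U. a < k y x')"
  shows "(\<lambda>(\<omega>, y). SUP x\<in>\<Union>\<U>. ereal (k y x) - H \<omega> x) \<in> borel_measurable (M \<Otimes>\<^sub>M borel_of T)"
  unfolding borel_measurable_ereal_iff_Ioi
proof
  fix c :: ereal
  define C where "C U q = {y \<in> topspace T. \<forall>x\<in>U. c \<le> ereal (k y x - q)}" for U q
  define B where "B U q = {\<omega> \<in> space M. \<exists>x\<in>U. H \<omega> x < ereal q}" for U q
  have C_sets: "C U q \<in> sets (borel_of T)" for U q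
  proof (cases "U = {}")
    case True
    then show ?thesis by (simp add: C_def closedin_sets_borel_of)
  next
    case False
    then have "C U q = (\<Inter>x\<in>U. {y \<in> topspace T. c \<le> ereal (k y x - q)})" by (auto simp: C_def)
    then show ?thesis using False closedin_ge_ereal[OF k]
      by (auto intro!: closedin_sets_borel_of closedin_INT)
  qed
  have "(\<Union>(U, q)\<in>\<U> \<times> \<rat>. B U q \<times> C U q) \<in> sets (M \<Otimes>\<^sub>M borel_of T)"
    using cnt H C_sets
    by (intro sets.countable_UN') (auto simp: B_def countable_rat intro!: countable_SIGMA)
  also have "(\<Union>(U, q)\<in>\<U> \<times> \<rat>. B U q \<times> C U q) =
      (\<lambda>(\<omega>, y). SUP x\<in>\<Union>\<U>. ereal (k y x) - H \<omega> x) -` {c<..} \<inter> space (M \<Otimes>\<^sub>M borel_of T)"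
    (is "?l = ?r")
  proof
    show "?l \<subseteq> ?r"
    proof
      fix z assume "z \<in> ?l"
      then obtain U q \<omega> y where z: "z = (\<omega>, y)" and U: "U \<in> \<U>" "\<omega> \<in> B U q" "y \<in> C U q"
        by auto
      then obtain x where x: "x \<in> U" "H \<omega> x < ereal q" by (auto simp: B_def)
      with U have "c \<le> ereal (k y x - q)" by (auto simp: C_def)
      also have "\<dots> < ereal (k y x) - H \<omega> x"
        using x(2) by (simp add: ereal_less_minus_swap)
      finally have "c < (SUP x\<in>\<Union>\<U>. ereal (k y x) - H \<omega> x)"
        using x U(1) by (auto simp: less_SUP_iff)
      then show "z \<in> ?r" using U z by (auto simp: B_def C_def space_pair_measure)
    qed
    show "?r \<subseteq> ?l"
    proof
      fix z assume "z \<in> ?r"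
      then obtain \<omega> y where z: "z = (\<omega>, y)" and *: "(\<omega>, y) \<in> space (M \<Otimes>\<^sub>M borel_of T)"
        "c < (SUP x\<in>\<Union>\<U>. ereal (k y x) - H \<omega> x)"
        by (cases z) auto
      then have sp: "\<omega> \<in> space M" "y \<in> topspace T" by (auto simp: space_pair_measure)
      from * obtain x where x: "x \<in> \<Union>\<U>" "c < ereal (k y x) - H \<omega> x" by (auto simp: less_SUP_iff)
      from x(2) have "H \<omega> x < ereal (k y x) - c" by (simp add: ereal_less_minus_swap)
      then obtain q where q: "H \<omega> x < ereal (real_of_rat q)" "ereal (real_of_rat q) < ereal (k y x) - c"
        using ereal_dense3 by blast
      let ?q = "real_of_rat q"
      from q(2) have "c < ereal (k y x) - ereal ?q" by (subst ereal_less_minus_swap)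
      then have "c < ereal (k y x - ?q)" by simp
      then obtain a where a: "c < ereal a" "a < k y x - ?q" using ereal_dense2 by force
      then have "a + ?q < k y x" by simp
      from loc[OF x(1) sp(2) this] obtain U where U: "U \<in> \<U>" "x \<in> U" "\<And>x'. x' \<in> U \<Longrightarrow> a + ?q < k y x'"
        by blast
      have "c \<le> ereal (k y x' - ?q)" if "x' \<in> U" for x'
        by (rule order_trans[OF less_imp_le[OF a(1)]]) (use U(3)[OF that] in simp)
      then have "\<omega> \<in> B U ?q" "y \<in> C U ?q" using sp q(1) U by (auto simp: B_def C_def)
      then show "z \<in> ?l" using U(1) z by (intro UN_I[of "(U, ?q)"]) auto
    qed
  qed
  finally show "(\<lambda>(\<omega>, y). SUP x\<in>\<Union>\<U>. ereal (k y x) - H \<omega> x) -` {c<..} \<inter> space (M \<Otimes>\<^sub>M borel_of T)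
      \<in> sets (M \<Otimes>\<^sub>M borel_of T)" .
qed

section \<open>Compact sets of functions and coordinates on dual balls\<close>

text \<open>
  The Banach-Alaoglu theorem in the product topology: Tychonoff's theorem makes the box compact, and
  linearity is a closed condition.
\<close>
lemma compact_bounded_linear_functions:
  "compact {z :: 'v::real_normed_vector \<Rightarrow> real. linear z \<and> (\<forall>v. \<bar>z v\<bar> \<le> R * norm v)}"
proof -
  let ?P = "PiE UNIV (\<lambda>v::'v. {- (R * norm v)..R * norm v})"
  let ?L = "{z :: 'v \<Rightarrow> real. \<forall>u v. z (u + v) = z u + z v} \<inter> {z. \<forall>c v. z (c *\<^sub>R v) = c * z v}"
  have "compactin (product_topology (\<lambda>_. euclidean) UNIV) ?P"
    by (simp add: compactin_PiE)
  then have "compact ?P" by (simp add: euclidean_product_topology)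
  moreover have "closed ?L"
    by (intro closed_Int closed_Collect_all closed_Collect_eq continuous_intros
        continuous_on_product_coordinates)
  ultimately have "compact (?P \<inter> ?L)" by (rule compact_Int_closed)
  also have "?P \<inter> ?L = {z. linear z \<and> (\<forall>v. \<bar>z v\<bar> \<le> R * norm v)}"
    by (auto simp: linear_iff abs_le_iff PiE_iff) (smt (verit))+
  finally show ?thesis .
qed

lemma continuous_on_coordinates: "continuous_on S (\<lambda>z :: 'a \<Rightarrow> real. \<lambda>i. z (a i))"
  by (intro continuous_on_coordinatewise_then_product continuous_on_subset[OF continuous_on_product_coordinates]) auto

text \<open>
  A functional is determined by its values along a dense sequence. On the compact dual ball the
  evaluation along the sequence is therefore a homeomorphism onto its image \<open>K\<close>, a closed set in
  \<open>\<nat> \<Rightarrow> \<real>\<close>; \<open>G\<close> is the inverse.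
\<close>
lemma dual_ball_coordinates:
  fixes d :: "nat \<Rightarrow> 'e::real_normed_vector" and m :: real
  assumes d: "closure (range d) = UNIV" and m: "0 \<le> m"
  obtains K and G :: "(nat \<Rightarrow> real) \<Rightarrow> 'e \<Rightarrow>\<^sub>L real" where "closed K"
    "\<And>\<phi> :: 'e \<Rightarrow>\<^sub>L real. norm \<phi> \<le> m \<Longrightarrow> (\<lambda>i. blinfun_apply \<phi> (d i)) \<in> K \<and> G (\<lambda>i. blinfun_apply \<phi> (d i)) = \<phi>"
    "\<And>x. x \<in> K \<Longrightarrow> norm (G x) \<le> m \<and> (\<lambda>i. blinfun_apply (G x) (d i)) = x"
    "\<And>e. continuous_on K (\<lambda>x. blinfun_apply (G x) e)"
proof -
  define Z where "Z = {z :: 'e \<Rightarrow> real. linear z \<and> (\<forall>v. \<bar>z v\<bar> \<le> m * norm v)}"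
  define P where "P z = (\<lambda>i. z (d i))" for z :: "'e \<Rightarrow> real"
  define G where "G x = Blinfun (the_inv_into Z P x)" for x
  have Z: "compact Z" unfolding Z_def by (rule compact_bounded_linear_functions)
  have P: "continuous_on Z P" unfolding P_def by (rule continuous_on_coordinates)
  have bl: "bounded_linear z" if "z \<in> Z" for z
    using that unfolding Z_def
    by (auto simp: mult.commute intro!: bounded_linear_intro[of z m] simp: linear_add linear_scale)
  have inj: "inj_on P Z"
  proof
    fix z z' assume z: "z \<in> Z" "z' \<in> Z" "P z = P z'"
    have cont: "continuous_on UNIV z" "continuous_on UNIV z'"
      using z bl by (auto intro: linear_continuous_on)
    have "closed {x. z x = z' x}" using cont by (rule closed_Collect_eq)
    moreover have "range d \<subseteq> {x. z x = z' x}" using z(3) by (auto simp: P_def fun_eq_iff)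
    ultimately have "UNIV \<subseteq> {x. z x = z' x}" using closure_minimal d by metis
    then show "z = z'" by auto
  qed
  have blf: "blinfun_apply \<phi> \<in> Z" if "norm \<phi> \<le> m" for \<phi> :: "'e \<Rightarrow>\<^sub>L real"
    using norm_blinfun[of \<phi>] mult_right_mono[OF that norm_ge_zero]
    by (auto simp: Z_def bounded_linear.linear[OF blinfun.bounded_linear_right] intro: order_trans)
  have G: "blinfun_apply (G x) = the_inv_into Z P x \<and> the_inv_into Z P x \<in> Z \<and> P (the_inv_into Z P x) = x"
    if "x \<in> P ` Z" for x
    using that inj bl by (auto simp: G_def the_inv_into_f_f bounded_linear_Blinfun_apply)
  show thesis
  proof
    show "closed (P ` Z)" using compact_continuous_image[OF P Z] by (rule compact_imp_closed)
    show "(\<lambda>i. blinfun_apply \<phi> (d i)) \<in> P ` Z \<and> G (\<lambda>i. blinfun_apply \<phi> (d i)) = \<phi>" if "norm \<phi> \<le> m" for \<phi> :: "'e \<Rightarrow>\<^sub>L real"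
      using blf[OF that] the_inv_into_f_f[OF inj blf[OF that]]
      by (auto simp: G_def P_def blinfun_apply_inverse image_iff)
    show "norm (G x) \<le> m \<and> (\<lambda>i. blinfun_apply (G x) (d i)) = x" if "x \<in> P ` Z" for x
      using G[OF that] m by (auto simp: P_def Z_def intro!: norm_blinfun_bound)
    have "continuous_on (P ` Z) (the_inv_into Z P)" by (rule continuous_on_inv_into[OF P Z inj])
    then have "continuous_on (P ` Z) (\<lambda>x. the_inv_into Z P x e)" for e
      by (rule continuous_on_product_then_coordinatewise)
    then show "continuous_on (P ` Z) (\<lambda>x. blinfun_apply (G x) e)" for e
      using G by (simp cong: continuous_on_cong)
  qed
qed

section \<open>Weak convergence\<close>

definition evaluation :: "'e::real_normed_vector \<Rightarrow> ('e \<Rightarrow>\<^sub>L real) \<Rightarrow> real" where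
  "evaluation e \<phi> = blinfun_apply \<phi> e"

lemma weak_topology_eq: "weak_topology = pullback_topology UNIV evaluation euclidean"
  by (simp add: weak_topology_def evaluation_def[abs_def])

lemma continuous_map_weak_topology_evaluation: "continuous_map weak_topology euclidean evaluation"
  using continuous_map_pullback[of euclidean euclidean id UNIV evaluation]
  by (simp add: weak_topology_eq)

lemma continuous_map_weak_topology_apply:
  fixes \<phi> :: "'e::real_normed_vector \<Rightarrow>\<^sub>L real"
  shows "continuous_map weak_topology euclidean (blinfun_apply \<phi>)"
proof -
  have "continuous_map euclidean euclidean (\<lambda>z :: ('e \<Rightarrow>\<^sub>L real) \<Rightarrow> real. z \<phi>)"
    by simp
  from continuous_map_compose[OF continuous_map_weak_topology_evaluation this]
  show ?thesis by (simp add: o_def evaluation_def[abs_def])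
qed

lemma limitin_weak_topology_iff:
  fixes s :: "'n \<Rightarrow> 'e::real_normed_vector"
  shows "limitin weak_topology s e F \<longleftrightarrow> (\<forall>\<phi> :: 'e \<Rightarrow>\<^sub>L real. ((\<lambda>n. blinfun_apply \<phi> (s n)) \<longlongrightarrow> blinfun_apply \<phi> e) F)"
proof -
  have "limitin weak_topology s e F \<longleftrightarrow> limitin euclidean (\<lambda>n. evaluation (s n)) (evaluation e) F"
    by (auto simp: limitin_def weak_topology_eq openin_pullback_topology topspace_pullback_topology)
  also have "\<dots> \<longleftrightarrow> limitin (product_topology (\<lambda>_. euclidean) UNIV) (\<lambda>n. evaluation (s n)) (evaluation e) F"
    by (simp add: euclidean_product_topology)
  also have "\<dots> \<longleftrightarrow> (\<forall>\<phi> :: 'e \<Rightarrow>\<^sub>L real. ((\<lambda>n. blinfun_apply \<phi> (s n)) \<longlongrightarrow> blinfun_apply \<phi> e) F)"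
    by (simp add: limitin_componentwise evaluation_def)
  finally show ?thesis .
qed

lemma norm_bidual_embedding_le: "norm (bidual_embedding e) \<le> norm e"
proof (rule norm_blinfun_bound)
  show "norm (blinfun_apply (bidual_embedding e) \<phi>) \<le> norm e * norm \<phi>" for \<phi>
    using norm_blinfun[of \<phi> e] by (simp add: bidual_embedding_apply mult.commute)
qed simp

lemma bidual_embedding_diff: "bidual_embedding (x - y) = bidual_embedding x - bidual_embedding y"
  by (rule blinfun_eqI) (simp add: bidual_embedding_apply blinfun.diff_right blinfun.diff_left)

lemma abs_apply_le_norm_bidual: "\<bar>blinfun_apply \<phi> e\<bar> \<le> norm (bidual_embedding e) * norm \<phi>"
  using norm_blinfun[of "bidual_embedding e" \<phi>] by (simp add: bidual_embedding_apply)

text \<open>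
  For each member \<open>d i\<close> of a dense sequence, \<open>\<psi> i\<close> almost attains
  the norm of \<open>d i\<close> in the bidual. A vector annihilated by all \<open>\<psi> i\<close> is close to some \<open>d i\<close>, whose
  norm in the bidual is then small.
\<close>
lemma exists_countable_separating_functionals:
  obtains \<psi> :: "nat \<Rightarrow> ('e::{real_normed_vector, second_countable_topology} \<Rightarrow>\<^sub>L real)"
  where "\<And>v (\<phi> :: 'e \<Rightarrow>\<^sub>L real). (\<And>i. blinfun_apply (\<psi> i) v = 0) \<Longrightarrow> blinfun_apply \<phi> v = 0"
proof -
  obtain d :: "nat \<Rightarrow> 'e" where d: "closure (range d) = UNIV" by (rule exists_dense_sequence)
  have "\<exists>\<psi>. norm \<psi> \<le> 1 \<and> norm (bidual_embedding (d i)) \<le> 2 * \<bar>blinfun_apply \<psi> (d i)\<bar>" for i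
  proof (rule ccontr)
    assume neg: "\<nexists>\<psi>. norm \<psi> \<le> 1 \<and> norm (bidual_embedding (d i)) \<le> 2 * \<bar>blinfun_apply \<psi> (d i)\<bar>"
    let ?b = "norm (bidual_embedding (d i))"
    have "norm (blinfun_apply (bidual_embedding (d i)) \<phi>) \<le> ?b / 2 * norm \<phi>" for \<phi>
    proof (cases "\<phi> = 0")
      case False
      have "norm ((1 / norm \<phi>) *\<^sub>R \<phi>) \<le> 1" using False by simp
      then have "2 * \<bar>blinfun_apply ((1 / norm \<phi>) *\<^sub>R \<phi>) (d i)\<bar> < ?b" using neg by (meson not_le)
      then show ?thesis using False
        by (simp add: bidual_embedding_apply blinfun.scaleR_left abs_mult field_simps)
    qed simp
    then have "?b \<le> ?b / 2" by (intro norm_blinfun_bound) auto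
    then have "?b = 0" by simp
    then show False using neg[simplified, rule_format, of 0] by simp
  qed
  then obtain \<psi> where \<psi>: "\<And>i. norm (\<psi> i) \<le> 1"
    "\<And>i. norm (bidual_embedding (d i)) \<le> 2 * \<bar>blinfun_apply (\<psi> i) (d i)\<bar>" by metis
  show thesis
  proof
    fix v and \<phi> :: "'e \<Rightarrow>\<^sub>L real" assume v: "\<And>i. blinfun_apply (\<psi> i) v = 0"
    have "norm (bidual_embedding v) \<le> 0"
    proof (rule field_le_epsilon)
      fix \<epsilon> :: real assume "\<epsilon> > 0"
      then have "\<epsilon> / 3 > 0" by simp
      moreover have "v \<in> closure (range d)" using d by simp
      ultimately obtain i where i: "dist (d i) v < \<epsilon> / 3"
        unfolding closure_approachable by blast
      have "\<bar>blinfun_apply (\<psi> i) (d i)\<bar> = \<bar>blinfun_apply (\<psi> i) (d i - v)\<bar>"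
        using v by (simp add: blinfun.diff_right)
      also have "\<dots> \<le> norm (\<psi> i) * norm (d i - v)" using norm_blinfun by (metis real_norm_def)
      also have "\<dots> \<le> 1 * (\<epsilon> / 3)" using \<psi>(1) i by (intro mult_mono) (auto simp: dist_norm)
      finally have "norm (bidual_embedding (d i)) \<le> 2 * (\<epsilon> / 3)" using \<psi>(2)[of i] by linarith
      moreover have "norm (bidual_embedding (d i - v)) \<le> \<epsilon> / 3"
        using norm_bidual_embedding_le[of "d i - v"] i by (simp add: dist_norm)
      moreover have "norm (bidual_embedding v) \<le> norm (bidual_embedding (d i)) + norm (bidual_embedding (d i - v))"
        using norm_triangle_ineq4[of "bidual_embedding (d i)" "bidual_embedding (d i - v)"]
        by (simp add: bidual_embedding_diff)
      ultimately show "norm (bidual_embedding v) \<le> 0 + \<epsilon>" by linarith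
    qed
    then show "blinfun_apply \<phi> v = 0" using abs_apply_le_norm_bidual[of \<phi> v] by simp
  qed
qed

text \<open>
  The half of the Eberlein-Smulian theorem that says that compactness implies sequential
  compactness. Since countably many functionals separate the points of the image of the space, the
  compact set \<open>C\<close> is homeomorphic to a subset of the metrizable space \<open>\<nat> \<Rightarrow> \<real>\<close>.
\<close>
lemma weakly_convergent_subsequence:
  fixes x :: "nat \<Rightarrow> 'e::{real_normed_vector, second_countable_topology}"
  assumes C: "compact C" "C \<subseteq> range evaluation" and x: "\<And>n. evaluation (x n) \<in> C"
  obtains r y where "strict_mono r" "limitin weak_topology (x \<circ> r) y sequentially"
proof -
  obtain \<psi> :: "nat \<Rightarrow> ('e \<Rightarrow>\<^sub>L real)"
    where \<psi>: "\<And>v (\<phi> :: 'e \<Rightarrow>\<^sub>L real). (\<And>i. blinfun_apply (\<psi> i) v = 0) \<Longrightarrow> blinfun_apply \<phi> v = 0"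
    using exists_countable_separating_functionals by metis
  define P where "P z = (\<lambda>i. z (\<psi> i))" for z :: "('e \<Rightarrow>\<^sub>L real) \<Rightarrow> real"
  have P: "continuous_on C P" unfolding P_def by (rule continuous_on_coordinates)
  have inj: "inj_on P C"
  proof
    fix z z' assume z: "z \<in> C" "z' \<in> C" "P z = P z'"
    then obtain u v where uv: "z = evaluation u" "z' = evaluation v" using C(2) by blast
    have "blinfun_apply (\<psi> i) (u - v) = 0" for i
      using z(3) by (simp add: P_def uv evaluation_def fun_eq_iff blinfun.diff_right)
    then have "blinfun_apply \<phi> (u - v) = 0" for \<phi> :: "'e \<Rightarrow>\<^sub>L real" by (rule \<psi>)
    then show "z = z'" by (simp add: uv evaluation_def fun_eq_iff blinfun.diff_right)
  qed
  have "seq_compact (P ` C)"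
    using compact_continuous_image[OF P C(1)] by (rule compact_imp_seq_compact)
  then obtain l r where l: "l \<in> P ` C" "strict_mono r" "((\<lambda>n. P (evaluation (x n))) \<circ> r) \<longlonglongrightarrow> l"
    using x unfolding seq_compact_def by (meson imageI)
  then obtain y where y: "l = P (evaluation y)" "evaluation y \<in> C" using C(2) by blast
  have inv: "continuous_on (P ` C) (the_inv_into C P)" by (rule continuous_on_inv_into[OF P C(1) inj])
  have "(\<lambda>n. the_inv_into C P (P (evaluation (x (r n))))) \<longlonglongrightarrow> the_inv_into C P l"
    by (rule continuous_on_tendsto_compose[OF inv]) (use l x in \<open>auto simp: o_def\<close>)
  then have "(\<lambda>n. evaluation (x (r n))) \<longlonglongrightarrow> evaluation y"
    using x y by (simp add: the_inv_into_f_f[OF inj])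
  then have "(\<lambda>n. evaluation (x (r n)) \<phi>) \<longlonglongrightarrow> evaluation y \<phi>" for \<phi>
    by (rule continuous_on_tendsto_compose[OF continuous_on_product_coordinates]) auto
  then have "limitin weak_topology (x \<circ> r) y sequentially"
    by (simp add: limitin_weak_topology_iff evaluation_def)
  then show thesis using l(2) that by blast
qed

lemma compact_evaluation_image_if_weakly_compact:
  assumes "compactin weak_topology K" shows "compact (evaluation ` K)"
  using image_compactin[OF assms continuous_map_weak_topology_evaluation] by simp

text \<open>
  By Banach-Alaoglu the ball of the bidual is compact, and by reflexivity each of its members is an
  evaluation.
\<close>
lemma reflexive_bidual_ball_evaluation:
  fixes R :: real
  assumes "reflexive_space TYPE('e::real_normed_vector)"
  obtains C :: "(('e::real_normed_vector \<Rightarrow>\<^sub>L real) \<Rightarrow> real) set" where "compact C" "C \<subseteq> range evaluation"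
    "\<And>e. norm (bidual_embedding (e::'e)) \<le> R \<Longrightarrow> evaluation e \<in> C"
proof
  let ?C = "{z :: ('e \<Rightarrow>\<^sub>L real) \<Rightarrow> real. linear z \<and> (\<forall>v. \<bar>z v\<bar> \<le> R * norm v)}"
  show "compact ?C" by (rule compact_bounded_linear_functions)
  show "?C \<subseteq> range evaluation"
  proof clarify
    fix z :: "('e \<Rightarrow>\<^sub>L real) \<Rightarrow> real" assume z: "linear z" "\<forall>v. \<bar>z v\<bar> \<le> R * norm v"
    then have "bounded_linear z"
      by (auto simp: mult.commute intro!: bounded_linear_intro[of z R] simp: linear_add linear_scale)
    moreover obtain e where "Blinfun z = bidual_embedding e"
      using assms unfolding reflexive_space_def by (metis surjD)
    ultimately have "z = evaluation e"
      by (metis bidual_embedding_apply bounded_linear_Blinfun_apply evaluation_def ext)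
    then show "z \<in> range evaluation" by blast
  qed
  fix e :: 'e assume e: "norm (bidual_embedding e) \<le> R"
  have "linear (evaluation e)"
    by (rule linearI) (simp_all add: evaluation_def blinfun.add_left blinfun.scaleR_left)
  moreover have "\<bar>evaluation e v\<bar> \<le> R * norm v" for v
    using abs_apply_le_norm_bidual[of v e] mult_right_mono[OF e norm_ge_zero, of v]
    by (simp add: evaluation_def)
  ultimately show "evaluation e \<in> ?C" by simp
qed

text \<open>
  By Baire's theorem one of the closed sets \<open>A k\<close>, on which all \<open>T n\<close> are bounded by \<open>k\<close>, contains a ball.
\<close>
lemma uniform_boundedness:
  fixes T :: "nat \<Rightarrow> 'a::banach \<Rightarrow>\<^sub>L 'b::real_normed_vector"
  assumes "\<And>x. bounded (range (\<lambda>n. T n x))"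
  obtains R :: nat where "\<And>n. norm (T n) \<le> real R"
proof -
  define A where "A k = {x. \<forall>n. norm (T n x) \<le> real k}" for k :: nat
  have cl: "closed (A k)" for k
    unfolding A_def by (intro closed_Collect_all closed_Collect_le continuous_intros)
  have "(\<Union>k. A k) = UNIV"
  proof -
    have "\<exists>k. x \<in> A k" for x
    proof -
      obtain B where B: "\<And>n. norm (T n x) \<le> B" using assms[of x] by (auto simp: bounded_iff)
      obtain k where "B \<le> real k" using real_arch_simple by blast
      then have "x \<in> A k" using B order_trans by (fastforce simp: A_def)
      then show ?thesis ..
    qed
    then show ?thesis by blast
  qed
  moreover have "interior (\<Union>(range A)) = {}" if "\<And>k. interior (A k) = {}"
  proof -
    have "(euclidean :: 'a topology) interior_of \<Union>(range A) = {}"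
      by (rule Baire_category_alt)
        (use cl that completely_metrizable_space_euclidean in \<open>auto simp: euclidean_interior_of\<close>)
    then show ?thesis by (simp add: euclidean_interior_of)
  qed
  ultimately obtain k x0 where "x0 \<in> interior (A k)" by fastforce
  then obtain \<delta> where \<delta>: "\<delta> > 0" "cball x0 \<delta> \<subseteq> A k" by (meson mem_interior_cball)
  have bound: "norm (T n x) \<le> (2 * real k / \<delta>) * norm x" for n x
  proof (cases "x = 0")
    case False
    let ?y = "x0 + (\<delta> / norm x) *\<^sub>R x"
    have "?y \<in> A k" "x0 \<in> A k" using \<delta> False by (auto simp: dist_norm intro!: subsetD[OF \<delta>(2)])
    then have "norm (T n ?y) \<le> real k" "norm (T n x0) \<le> real k" by (auto simp: A_def)
    then have "norm (T n ?y - T n x0) \<le> 2 * real k" using norm_triangle_ineq4[of "T n ?y" "T n x0"] by linarith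
    then have "\<delta> / norm x * norm (T n x) \<le> 2 * real k"
      using \<delta> by (simp add: blinfun.add_right blinfun.scaleR_right)
    then show ?thesis using \<delta> False by (simp add: field_simps)
  qed simp
  obtain R :: nat where "2 * real k / \<delta> \<le> real R" using real_arch_simple by blast
  moreover have "norm (T n) \<le> 2 * real k / \<delta>" for n
    using \<delta> bound by (intro norm_blinfun_bound) auto
  ultimately show thesis using that order_trans by blast
qed

text \<open>
  The members of the sequence, regarded as operators on the dual, are pointwise bounded there.
\<close>
lemma weakly_convergent_bounded:
  fixes s :: "nat \<Rightarrow> 'e::real_normed_vector"
  assumes "limitin weak_topology s e sequentially"
  obtains R :: nat where "\<And>n. norm (bidual_embedding (s n)) \<le> real R"
proof (rule uniform_boundedness[of "\<lambda>n. bidual_embedding (s n)"])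
  show "bounded (range (\<lambda>n. blinfun_apply (bidual_embedding (s n)) \<phi>))" for \<phi>
    using assms convergent_imp_bounded[of "\<lambda>n. blinfun_apply \<phi> (s n)" "blinfun_apply \<phi> e"]
    by (simp add: limitin_weak_topology_iff bidual_embedding_apply)
qed (rule that)

section \<open>The conjugate of the sequential weak epi-limit\<close>
lemma limsup_tendsto_minus:
  fixes b :: "nat \<Rightarrow> ereal"
  assumes "a \<longlonglongrightarrow> l"
  shows "limsup (\<lambda>n. ereal (a n) - b n) = ereal l - liminf b"
proof -
  have "limsup (\<lambda>n. ereal (a n) + - b n) = ereal l + limsup (\<lambda>n. - b n)"
    using assms by (intro ereal_limsup_lim_add) auto
  then show ?thesis by (simp add: minus_ereal_def ereal_Limsup_uminus)
qed

text \<open>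
  Measuring size in the bidual suits both inequalities below: weakly convergent sequences are bounded
  in this sense by the uniform boundedness principle, and reflexivity makes these balls weakly compact.
\<close>
definition bidual_ball :: "real \<Rightarrow> 'e::real_normed_vector set" where
  "bidual_ball R = {e. norm (bidual_embedding e) \<le> R}"

lemma closed_bidual_ball: "closed (bidual_ball R :: 'e::real_normed_vector set)"
proof -
  have "bounded_linear (bidual_embedding :: 'e \<Rightarrow> _)"
  proof (rule bounded_linear_intro)
    show "norm (bidual_embedding x) \<le> norm x * 1" for x :: 'e by (simp add: norm_bidual_embedding_le)
    show "bidual_embedding (x + y) = bidual_embedding x + bidual_embedding y" for x y :: 'e
      by (rule blinfun_eqI) (simp add: bidual_embedding_apply blinfun.add_right blinfun.add_left)
    show "bidual_embedding (r *\<^sub>R x) = r *\<^sub>R bidual_embedding x" for r and x :: 'e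
      by (rule blinfun_eqI) (simp add: bidual_embedding_apply blinfun.scaleR_right blinfun.scaleR_left)
  qed
  then show ?thesis unfolding bidual_ball_def
    by (intro closed_Collect_le continuous_on_norm linear_continuous_on continuous_on_const)
qed

text \<open>
  A weakly convergent sequence stays in one ball of the bidual, so the differences along it are
  dominated by the suprema over that ball.
\<close>
lemma conjugate_seq_weak_li_le:
  "conjugate (seq_weak_li g) \<phi> \<le>
     (SUP R::nat. limsup (\<lambda>n. SUP e\<in>bidual_ball (real R). ereal (blinfun_apply \<phi> e) - g n e))"
  (is "_ \<le> ?T")
  unfolding conjugate_def
proof (rule SUP_least)
  fix e
  have "ereal (blinfun_apply \<phi> e) - ?T \<le> liminf (\<lambda>n. g n (s n))"
    if s: "limitin weak_topology s e sequentially" for s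
  proof -
    obtain R :: nat where R: "\<And>n. norm (bidual_embedding (s n)) \<le> real R"
      using weakly_convergent_bounded[OF s] by blast
    have "ereal (blinfun_apply \<phi> e) - liminf (\<lambda>n. g n (s n)) =
        limsup (\<lambda>n. ereal (blinfun_apply \<phi> (s n)) - g n (s n))"
      using s by (intro limsup_tendsto_minus[symmetric]) (simp add: limitin_weak_topology_iff)
    also have "\<dots> \<le> limsup (\<lambda>n. SUP e\<in>bidual_ball (real R). ereal (blinfun_apply \<phi> e) - g n e)"
      using R by (intro Limsup_mono always_eventually allI SUP_upper) (simp add: bidual_ball_def)
    also have "\<dots> \<le> ?T" by (rule SUP_upper) simp
    finally show ?thesis by (subst ereal_minus_le_swap)
  qed
  then have "ereal (blinfun_apply \<phi> e) - ?T \<le> seq_weak_li g e"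
    unfolding seq_weak_li_def by (auto intro!: Inf_greatest)
  then show "ereal (blinfun_apply \<phi> e) - seq_weak_li g e \<le> ?T" by (subst ereal_minus_le_swap)
qed

text \<open>
  Points \<open>z n\<close> at which the difference exceeds \<open>c\<close> exist for infinitely many \<open>n\<close>, and along some
  subsequence \<open>q\<close> of these indices they converge weakly to a point \<open>y\<close>. The epi-limit takes full
  sequences; setting the remaining members to \<open>y\<close> preserves convergence, and a limit superior is at
  least that along \<open>q\<close>.
\<close>
lemma le_conjugate_seq_weak_li:
  fixes g :: "nat \<Rightarrow> 'e::{real_normed_vector, second_countable_topology} \<Rightarrow> ereal"
  assumes C: "compact C" "C \<subseteq> range evaluation"
    and S: "\<And>n e. j \<le> n \<Longrightarrow> e \<in> S \<Longrightarrow> c < ereal (blinfun_apply \<phi> e) - g n e \<Longrightarrow> evaluation e \<in> C"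
    and c: "c < limsup (\<lambda>n. SUP e\<in>S. ereal (blinfun_apply \<phi> e) - g n e)"
  shows "c \<le> conjugate (seq_weak_li g) \<phi>"
proof -
  define N where "N = {n. j \<le> n \<and> (\<exists>e\<in>S. c < ereal (blinfun_apply \<phi> e) - g n e)}"
  have "\<exists>n\<ge>m. n \<in> N" for m
  proof (rule ccontr)
    assume "\<not> (\<exists>n\<ge>m. n \<in> N)"
    then have "(SUP e\<in>S. ereal (blinfun_apply \<phi> e) - g n e) \<le> c" if "max m j \<le> n" for n
      using that by (intro SUP_least) (auto simp: N_def not_less)
    then have "limsup (\<lambda>n. SUP e\<in>S. ereal (blinfun_apply \<phi> e) - g n e) \<le> c"
      by (intro Limsup_bounded) (auto simp: eventually_sequentially intro!: exI[of _ "max m j"])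
    with c show False by simp
  qed
  then have N: "infinite N" by (simp add: infinite_nat_iff_unbounded_le)
  have "\<forall>n\<in>N. \<exists>e. e \<in> S \<and> c < ereal (blinfun_apply \<phi> e) - g n e" by (auto simp: N_def)
  then obtain z where z: "\<And>n. n \<in> N \<Longrightarrow> z n \<in> S \<and> c < ereal (blinfun_apply \<phi> (z n)) - g n (z n)"
    by metis
  define r where "r = enumerate N"
  have r: "strict_mono r" "r k \<in> N" for k
    using strict_mono_enumerate[OF N] enumerate_in_set[OF N] by (auto simp: r_def)
  have "evaluation (z (r k)) \<in> C" for k
    using S[of "r k" "z (r k)"] z[OF r(2)] r(2)[of k] by (simp add: N_def)
  then obtain r' y where r': "strict_mono r'" "limitin weak_topology ((\<lambda>k. z (r k)) \<circ> r') y sequentially"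
    using weakly_convergent_subsequence[OF C, of "\<lambda>k. z (r k)"] by blast
  define q where "q = r \<circ> r'"
  have q: "strict_mono q" unfolding q_def using r(1) r'(1) by (rule strict_mono_o)
  define s where "s n = (if n \<in> range q then z n else y)" for n
  have s: "limitin weak_topology s y sequentially"
    unfolding limitin_weak_topology_iff
  proof
    fix \<phi>' :: "'e \<Rightarrow>\<^sub>L real"
    have lim: "(\<lambda>k. blinfun_apply \<phi>' (z (q k))) \<longlonglongrightarrow> blinfun_apply \<phi>' y"
      using r'(2) by (simp add: limitin_weak_topology_iff q_def)
    show "(\<lambda>n. blinfun_apply \<phi>' (s n)) \<longlonglongrightarrow> blinfun_apply \<phi>' y"
    proof (rule metric_LIMSEQ_I)
      fix \<epsilon> :: real assume \<epsilon>: "0 < \<epsilon>"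
      obtain K where K: "\<And>k. K \<le> k \<Longrightarrow> dist (blinfun_apply \<phi>' (z (q k))) (blinfun_apply \<phi>' y) < \<epsilon>"
        using metric_LIMSEQ_D[OF lim \<epsilon>] by blast
      have "dist (blinfun_apply \<phi>' (s n)) (blinfun_apply \<phi>' y) < \<epsilon>" if "q K \<le> n" for n
      proof (cases "n \<in> range q")
        case True
        then obtain k where k: "n = q k" by blast
        then have "K \<le> k" using that strict_mono_less_eq[OF q] by simp
        then show ?thesis using K k by (simp add: s_def)
      qed (simp add: s_def \<epsilon>)
      then show "\<exists>m. \<forall>n\<ge>m. dist (blinfun_apply \<phi>' (s n)) (blinfun_apply \<phi>' y) < \<epsilon>" by blast
    qed
  qed
  let ?X = "\<lambda>n. ereal (blinfun_apply \<phi> (s n)) - g n (s n)"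
  have "c \<le> limsup (?X \<circ> q)"
  proof (rule le_Limsup)
    have "c < (?X \<circ> q) k" for k using z[of "q k"] r(2) by (simp add: s_def q_def)
    then show "\<forall>\<^sub>F k in sequentially. c \<le> (?X \<circ> q) k" by (simp add: less_imp_le)
  qed simp
  also have "\<dots> \<le> limsup ?X" using q by (rule limsup_subseq_mono)
  also have "\<dots> = ereal (blinfun_apply \<phi> y) - liminf (\<lambda>n. g n (s n))"
    using s by (intro limsup_tendsto_minus) (simp add: limitin_weak_topology_iff)
  also have "\<dots> \<le> ereal (blinfun_apply \<phi> y) - seq_weak_li g y"
    unfolding seq_weak_li_def using s by (intro ereal_minus_mono Inf_lower) auto
  also have "\<dots> \<le> conjugate (seq_weak_li g) \<phi>" unfolding conjugate_def by (rule SUP_upper) simp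
  finally show ?thesis .
qed

lemma conjugate_seq_weak_li_eq:
  fixes g :: "nat \<Rightarrow> 'e::{real_normed_vector, second_countable_topology} \<Rightarrow> ereal"
  assumes "(\<exists>h n0. inf_weakly_compact_every_slope h \<and> (\<forall>n\<ge>n0. \<forall>e. h e \<le> g n e)) \<or> reflexive_space TYPE('e)"
  shows "conjugate (seq_weak_li g) \<phi> =
     (SUP R::nat. limsup (\<lambda>n. SUP e\<in>bidual_ball (real R). ereal (blinfun_apply \<phi> e) - g n e))"
proof (rule antisym[OF conjugate_seq_weak_li_le SUP_least])
  fix R :: nat
  show "limsup (\<lambda>n. SUP e\<in>bidual_ball (real R). ereal (blinfun_apply \<phi> e) - g n e) \<le> conjugate (seq_weak_li g) \<phi>"
    (is "?l \<le> ?r")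
  proof (rule ccontr)
    assume "\<not> ?l \<le> ?r"
    then obtain c where c: "?r < ereal c" "ereal c < ?l" using ereal_dense2 by (auto simp: not_le)
    have "\<exists>C n0. compact C \<and> C \<subseteq> range evaluation \<and>
      (\<forall>n e. n0 \<le> n \<longrightarrow> e \<in> bidual_ball (real R) \<longrightarrow> ereal c < ereal (blinfun_apply \<phi> e) - g n e \<longrightarrow> evaluation e \<in> C)"
      using assms
    proof
      assume "reflexive_space TYPE('e)"
      then obtain C :: "(('e \<Rightarrow>\<^sub>L real) \<Rightarrow> real) set" where "compact C" "C \<subseteq> range evaluation"
        "\<And>e::'e. norm (bidual_embedding e) \<le> real R \<Longrightarrow> evaluation e \<in> C"
        using reflexive_bidual_ball_evaluation by metis
      then show ?thesis by (intro exI[of _ C] exI[of _ 0]) (simp add: bidual_ball_def)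
    next
      assume "\<exists>h n0. inf_weakly_compact_every_slope h \<and> (\<forall>n\<ge>n0. \<forall>e. h e \<le> g n e)"
      then obtain h n0 where h: "inf_weakly_compact_every_slope h" "\<And>n e. n \<ge> n0 \<Longrightarrow> h e \<le> g n e" by blast
      let ?K = "{e. h e - ereal (blinfun_apply \<phi> e) \<le> ereal (- c)}"
      have "compact (evaluation ` ?K)"
        using h(1) by (intro compact_evaluation_image_if_weakly_compact) (simp add: inf_weakly_compact_every_slope_def)
      moreover have "e \<in> ?K" if "n0 \<le> n" "ereal c < ereal (blinfun_apply \<phi> e) - g n e" for n e
      proof -
        have "ereal c < ereal (blinfun_apply \<phi> e) - h e"
          using that(2) ereal_minus_mono[OF order_refl h(2)[OF that(1)]] by (rule less_le_trans)
        then show ?thesis by (cases "h e") auto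
      qed
      ultimately show ?thesis by (intro exI[of _ "evaluation ` ?K"] exI[of _ n0]) blast
    qed
    then obtain C n0 where C: "compact C" "C \<subseteq> range evaluation"
      "\<And>n e. n0 \<le> n \<Longrightarrow> e \<in> bidual_ball (real R) \<Longrightarrow> ereal c < ereal (blinfun_apply \<phi> e) - g n e \<Longrightarrow> evaluation e \<in> C"
      by blast
    have "ereal c \<le> ?r"
      by (rule le_conjugate_seq_weak_li[where j=n0, OF C(1,2) _ c(2)]) (rule C(3))
    with c(1) show False by simp
  qed
qed

section \<open>Joint measurability\<close>
lemma sets_exists_less:
  fixes F :: "'w \<Rightarrow> 'x::{complete_space, second_countable_topology} \<Rightarrow> ereal"
  assumes M: "sigma_finite_measure M" "complete_measure M"
    and F: "(\<lambda>(\<omega>, x). F \<omega> x) \<in> borel_measurable (M \<Otimes>\<^sub>M borel)" and U: "U \<in> sets borel"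
  shows "{\<omega> \<in> space M. \<exists>x\<in>U. F \<omega> x < q} \<in> sets M"
proof -
  let ?A = "{p \<in> space (M \<Otimes>\<^sub>M borel). (case p of (\<omega>, x) \<Rightarrow> F \<omega> x) < q} \<inter> space M \<times> U"
  have "?A \<in> sets (M \<Otimes>\<^sub>M borel)"
    using F U by (intro sets.Int borel_measurable_less pair_measureI sets.top borel_measurable_const)
  from measurable_projection[OF M this] have "fst ` ?A \<in> sets M" .
  also have "fst ` ?A = {\<omega> \<in> space M. \<exists>x\<in>U. F \<omega> x < q}"
    by (force simp: space_pair_measure image_iff)
  finally show ?thesis .
qed

text \<open>
  The traces on \<open>S\<close> of a countable base of the norm topology suffice as the countable family, since each
  functional is norm continuous.
\<close>
lemma borel_measurable_SUP_apply:
  fixes F :: "'w \<Rightarrow> 'e::{banach, second_countable_topology} \<Rightarrow> ereal"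
  assumes M: "sigma_finite_measure M" "complete_measure M"
    and F: "(\<lambda>(\<omega>, x). F \<omega> x) \<in> borel_measurable (M \<Otimes>\<^sub>M borel)" and S: "S \<in> sets borel"
  shows "(\<lambda>(\<omega>, \<phi>). SUP e\<in>S. ereal (blinfun_apply \<phi> e) - F \<omega> e)
    \<in> borel_measurable (M \<Otimes>\<^sub>M borel_of weak_star_topology)"
proof -
  obtain \<B> :: "'e set set" where B: "countable \<B>" "topological_basis \<B>"
    using ex_countable_basis by blast
  define \<U> where "\<U> = (\<lambda>U. U \<inter> S) ` \<B>"
  have "\<exists>V\<in>\<B>. x \<in> V" for x using topological_basisE[OF B(2) open_UNIV] by blast
  then have U: "\<Union>\<U> = S" unfolding \<U>_def by blast
  have "(\<lambda>(\<omega>, \<phi>). SUP e\<in>\<Union>\<U>. ereal (blinfun_apply \<phi> e) - F \<omega> e)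
    \<in> borel_measurable (M \<Otimes>\<^sub>M borel_of weak_star_topology)"
  proof (rule borel_measurable_SUP_pairing)
    show "countable \<U>" unfolding \<U>_def using B(1) by simp
    show "{\<omega> \<in> space M. \<exists>x\<in>U. F \<omega> x < ereal q} \<in> sets M" if "U \<in> \<U>" for U q
      using that S topological_basis_open[OF B(2)]
      by (intro sets_exists_less[OF M F]) (auto simp: \<U>_def)
    show "continuous_map weak_star_topology euclidean (\<lambda>\<phi>. blinfun_apply \<phi> x)" for x :: 'e
      unfolding weak_star_topology_def by (rule strong_operator_topology_continuous_evaluation)
    fix x :: 'e and \<phi> :: "'e \<Rightarrow>\<^sub>L real" and a assume x: "x \<in> \<Union>\<U>" "a < blinfun_apply \<phi> x"
    have "open {x. a < blinfun_apply \<phi> x}" by (intro open_Collect_less continuous_intros)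
    then obtain V where "V \<in> \<B>" "x \<in> V" "V \<subseteq> {x. a < blinfun_apply \<phi> x}"
      using x(2) by (auto elim: topological_basisE[OF B(2)])
    then show "\<exists>U\<in>\<U>. x \<in> U \<and> (\<forall>x'\<in>U. a < blinfun_apply \<phi> x')"
      using x(1) U by (intro bexI[of _ "V \<inter> S"]) (auto simp: \<U>_def)
  qed
  then show ?thesis by (simp add: U)
qed

lemma lower_semicontinuous_conjugate: "lower_semicontinuous weak_star_topology (conjugate h)"
  unfolding conjugate_def[abs_def] weak_star_topology_def
  by (rule lower_semicontinuous_SUP_affine) (rule strong_operator_topology_continuous_evaluation)

lemma lower_semicontinuous_biconjugate: "lower_semicontinuous weak_topology (biconjugate h)"
  unfolding biconjugate_def[abs_def]
  by (rule lower_semicontinuous_SUP_affine) (rule continuous_map_weak_topology_apply)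

lemma borel_measurable_conjugate:
  fixes F :: "nat \<Rightarrow> 'w \<Rightarrow> 'e::{banach, second_countable_topology} \<Rightarrow> ereal"
  assumes M: "sigma_finite_measure M" "complete_measure M"
    and F: "\<And>n. (\<lambda>(\<omega>, e). F n \<omega> e) \<in> borel_measurable (M \<Otimes>\<^sub>M borel)"
    and f: "\<And>\<omega> e. \<omega> \<in> space M \<Longrightarrow> f \<omega> e = seq_weak_li (\<lambda>n. F n \<omega>) e"
    and ab: "quasi_inf_weakly_compact_every_slope M F \<or> reflexive_space TYPE('e)"
  shows "(\<lambda>(\<omega>, \<phi>). conjugate (f \<omega>) \<phi>) \<in> borel_measurable (M \<Otimes>\<^sub>M borel_of weak_star_topology)"
proof -
  define G where "G n R = (\<lambda>(\<omega>, \<phi>). SUP e\<in>bidual_ball (real R). ereal (blinfun_apply \<phi> e) - F n \<omega> e)"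
    for n and R :: nat
  have "G n R \<in> borel_measurable (M \<Otimes>\<^sub>M borel_of weak_star_topology)" for n R
    unfolding G_def by (intro borel_measurable_SUP_apply M F borel_closed closed_bidual_ball)
  then have "(\<lambda>p. SUP R. limsup (\<lambda>n. G n R p)) \<in> borel_measurable (M \<Otimes>\<^sub>M borel_of weak_star_topology)"
    by (intro borel_measurable_SUP borel_measurable_limsup) auto
  moreover have "(SUP R. limsup (\<lambda>n. G n R p)) = (case p of (\<omega>, \<phi>) \<Rightarrow> conjugate (f \<omega>) \<phi>)"
    if sp: "p \<in> space (M \<Otimes>\<^sub>M borel_of weak_star_topology)" for p
  proof -
    obtain \<omega> \<phi> where p: "p = (\<omega>, \<phi>)" "\<omega> \<in> space M"
      using sp by (cases p) (auto simp: space_pair_measure)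
    have f_eq: "f \<omega> = seq_weak_li (\<lambda>n. F n \<omega>)" using f[OF p(2)] by blast
    have "(\<exists>h n0. inf_weakly_compact_every_slope h \<and> (\<forall>n\<ge>n0. \<forall>e. h e \<le> F n \<omega> e)) \<or> reflexive_space TYPE('e)"
      using ab p(2) unfolding quasi_inf_weakly_compact_every_slope_def by blast
    from conjugate_seq_weak_li_eq[OF this, of \<phi>]
    show ?thesis by (simp add: p f_eq G_def)
  qed
  ultimately show ?thesis by (simp cong: measurable_cong)
qed

text \<open>
  The dual need not be second countable in the weak-star topology, but its balls are. The
  countable family consists of the sets of functionals in the ball of radius \<open>m\<close> whose coordinates
  along a dense sequence lie in a basic open set. A question about the existence of such a functional is
  transported along the coordinates to \<open>\<nat> \<Rightarrow> \<real>\<close>, where the projection theorem applies.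
\<close>
lemma borel_measurable_biconjugate:
  fixes f :: "'w \<Rightarrow> 'e::{banach, second_countable_topology} \<Rightarrow> ereal"
  assumes M: "sigma_finite_measure M" "complete_measure M"
    and meas: "(\<lambda>(\<omega>, \<phi>). conjugate (f \<omega>) \<phi>) \<in> borel_measurable (M \<Otimes>\<^sub>M borel_of weak_star_topology)"
  shows "(\<lambda>(\<omega>, e). biconjugate (f \<omega>) e) \<in> borel_measurable (M \<Otimes>\<^sub>M borel_of weak_topology)"
proof -
  obtain d :: "nat \<Rightarrow> 'e" where d: "closure (range d) = UNIV" by (rule exists_dense_sequence)
  define J where "J \<phi> = (\<lambda>i. blinfun_apply \<phi> (d i))" for \<phi> :: "'e \<Rightarrow>\<^sub>L real"
  have "\<exists>K G. closed K \<and> (\<forall>\<phi>. norm \<phi> \<le> real m \<longrightarrow> J \<phi> \<in> K \<and> G (J \<phi>) = \<phi>) \<and>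
     (\<forall>x\<in>K. norm (G x) \<le> real m \<and> J (G x) = x) \<and> (\<forall>e. continuous_on K (\<lambda>x. blinfun_apply (G x) e))" for m :: nat
    unfolding J_def by (rule dual_ball_coordinates[OF d, of "real m"]) (simp, blast)
  then obtain K G where K: "\<And>m. closed (K m)"
    and GJ: "\<And>m \<phi>. norm \<phi> \<le> real m \<Longrightarrow> J \<phi> \<in> K m \<and> G m (J \<phi>) = \<phi>"
    and JG: "\<And>m x. x \<in> K m \<Longrightarrow> norm (G m x) \<le> real m \<and> J (G m x) = x"
    and G: "\<And>m e. continuous_on (K m) (\<lambda>x. blinfun_apply (G m x) e)"
    by metis
  obtain \<B> :: "(nat \<Rightarrow> real) set set" where B: "countable \<B>" "topological_basis \<B>"
    using ex_countable_basis by blast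
  define \<U> where "\<U> = (\<lambda>(m, V). {\<phi>. norm \<phi> \<le> real m \<and> J \<phi> \<in> V}) ` (UNIV \<times> \<B>)"
  have cover: "\<exists>U\<in>\<U>. \<phi> \<in> U \<and> (\<forall>\<psi>\<in>U. a < blinfun_apply \<psi> e)" if a: "a < blinfun_apply \<phi> e" for \<phi> e a
  proof -
    obtain m :: nat where m: "norm \<phi> \<le> real m" using real_arch_simple by blast
    have "openin (top_of_set (K m)) (K m \<inter> (\<lambda>x. blinfun_apply (G m x) e) -` {a<..})"
      using G by (rule continuous_openin_preimage_gen) simp
    then obtain W where W: "open W" "K m \<inter> (\<lambda>x. blinfun_apply (G m x) e) -` {a<..} = K m \<inter> W"
      by (auto simp: openin_open)
    have "J \<phi> \<in> W" using GJ[OF m] a W(2) by auto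
    then obtain V where V: "V \<in> \<B>" "J \<phi> \<in> V" "V \<subseteq> W" using topological_basisE[OF B(2) W(1)] by metis
    have "a < blinfun_apply \<psi> e" if \<psi>: "norm \<psi> \<le> real m" "J \<psi> \<in> V" for \<psi>
    proof -
      have "J \<psi> \<in> K m \<inter> W" using GJ[OF \<psi>(1)] \<psi>(2) V(3) by auto
      then have "a < blinfun_apply (G m (J \<psi>)) e" using W(2) by blast
      then show ?thesis using GJ[OF \<psi>(1)] by simp
    qed
    then show ?thesis using V m unfolding \<U>_def
      by (intro bexI[of _ "{\<phi>. norm \<phi> \<le> real m \<and> J \<phi> \<in> V}"]) auto
  qed
  have U: "\<Union>\<U> = UNIV"
  proof -
    have "\<phi> \<in> \<Union>\<U>" for \<phi> using cover[of "blinfun_apply \<phi> 0 - 1" \<phi> 0] by auto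
    then show ?thesis by blast
  qed
  have "(\<lambda>(\<omega>, e). SUP \<phi>\<in>\<Union>\<U>. ereal (blinfun_apply \<phi> e) - conjugate (f \<omega>) \<phi>)
    \<in> borel_measurable (M \<Otimes>\<^sub>M borel_of weak_topology)"
  proof (rule borel_measurable_SUP_pairing)
    show "countable \<U>" unfolding \<U>_def using B(1) by auto
    show "continuous_map weak_topology euclidean (\<lambda>e. blinfun_apply \<phi> e)" for \<phi> :: "'e \<Rightarrow>\<^sub>L real"
      by (rule continuous_map_weak_topology_apply)
    show "\<exists>U\<in>\<U>. \<phi> \<in> U \<and> (\<forall>\<psi>\<in>U. a < blinfun_apply \<psi> e)" if "a < blinfun_apply \<phi> e" for \<phi> e a
      using that by (rule cover)
    fix U q assume "U \<in> \<U>"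
    then obtain m V where V: "V \<in> \<B>" "U = {\<phi>. norm \<phi> \<le> real m \<and> J \<phi> \<in> V}" unfolding \<U>_def by auto
    \<comment> \<open>Extending \<open>G m\<close> by \<open>0\<close> off the closed set \<open>K m\<close> makes it measurable on the whole Polish space.\<close>
    define G' where "G' x = (if x \<in> K m then G m x else 0)" for x
    have [measurable]: "G' \<in> borel \<rightarrow>\<^sub>M borel_of weak_star_topology"
      unfolding borel_of_def
    proof (rule measurable_measure_of)
      show "{U. openin weak_star_topology U} \<subseteq> Pow (topspace weak_star_topology)"
        by (auto dest: openin_subset)
      show "G' \<in> space borel \<rightarrow> topspace weak_star_topology"
        by (simp add: weak_star_topology_def strong_operator_topology_topspace)
      fix O' :: "('e \<Rightarrow>\<^sub>L real) set" assume "O' \<in> {U. openin weak_star_topology U}"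
      moreover have "continuous_map (top_of_set (K m)) weak_star_topology (G m)"
        unfolding weak_star_topology_def continuous_on_strong_operator_topo_iff_coordinatewise
        using G by simp
      ultimately have "openin (top_of_set (K m)) {x \<in> K m. G m x \<in> O'}"
        using openin_continuous_map_preimage by fastforce
      then obtain W where W: "open W" "{x \<in> K m. G m x \<in> O'} = K m \<inter> W" by (auto simp: openin_open)
      have "G' -` O' \<inter> space borel = (K m \<inter> W) \<union> (if 0 \<in> O' then - K m else {})"
      proof (rule set_eqI)
        fix x
        have "x \<in> K m \<Longrightarrow> G m x \<in> O' \<longleftrightarrow> x \<in> W" using W(2) by blast
        then show "x \<in> G' -` O' \<inter> space borel \<longleftrightarrow> x \<in> (K m \<inter> W) \<union> (if 0 \<in> O' then - K m else {})"
          by (cases "x \<in> K m"; cases "0 \<in> O'") (simp_all add: G'_def)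
      qed
      then show "G' -` O' \<inter> space borel \<in> sets borel" using K[of m] W(1) by auto
    qed
    have "(\<lambda>(\<omega>, x). conjugate (f \<omega>) (G' x)) \<in> borel_measurable (M \<Otimes>\<^sub>M borel)"
      using measurable_compose[OF _ meas, of "\<lambda>(\<omega>, x). (\<omega>, G' x)" "M \<Otimes>\<^sub>M borel"]
      by (simp add: case_prod_unfold)
    then have "{\<omega> \<in> space M. \<exists>x\<in>K m \<inter> V. conjugate (f \<omega>) (G' x) < ereal q} \<in> sets M"
      using K[of m] topological_basis_open[OF B(2) V(1)] by (intro sets_exists_less[OF M]) auto
    moreover have "(\<exists>x\<in>K m \<inter> V. conjugate (f \<omega>) (G' x) < ereal q) \<longleftrightarrow> (\<exists>\<phi>\<in>U. conjugate (f \<omega>) \<phi> < ereal q)" for \<omega>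
    proof
      assume "\<exists>x\<in>K m \<inter> V. conjugate (f \<omega>) (G' x) < ereal q"
      then obtain x where "x \<in> K m" "x \<in> V" "conjugate (f \<omega>) (G m x) < ereal q" by (auto simp: G'_def)
      then show "\<exists>\<phi>\<in>U. conjugate (f \<omega>) \<phi> < ereal q"
        using JG[of x m] by (intro bexI[of _ "G m x"]) (auto simp: V)
    next
      assume "\<exists>\<phi>\<in>U. conjugate (f \<omega>) \<phi> < ereal q"
      then obtain \<phi> where "norm \<phi> \<le> real m" "J \<phi> \<in> V" "conjugate (f \<omega>) \<phi> < ereal q" by (auto simp: V)
      then show "\<exists>x\<in>K m \<inter> V. conjugate (f \<omega>) (G' x) < ereal q"
        using GJ[of \<phi> m] by (intro bexI[of _ "J \<phi>"]) (auto simp: G'_def)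
    qed
    ultimately show "{\<omega> \<in> space M. \<exists>\<phi>\<in>U. conjugate (f \<omega>) \<phi> < ereal q} \<in> sets M" by simp
  qed
  then show ?thesis by (simp add: U biconjugate_def)
qed

theorem theorem4p6:
  fixes M :: "'w measure"
    and F :: "nat \<Rightarrow> 'w \<Rightarrow> 'e::{banach, second_countable_topology} \<Rightarrow> ereal"
    and f :: "'w \<Rightarrow> 'e \<Rightarrow> ereal"
  assumes "sigma_finite_measure M"
    and "complete_measure M"
    and "\<And>n. (\<lambda>(\<omega>, e). F n \<omega> e) \<in> borel_measurable (M \<Otimes>\<^sub>M borel)"
    and "\<And>\<omega> e. \<omega> \<in> space M \<Longrightarrow> f \<omega> e = seq_weak_li (\<lambda>n. F n \<omega>) e"
    and "quasi_inf_weakly_compact_every_slope M F \<or> reflexive_space TYPE('e)"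
  shows "normal_integrand M weak_star_topology (\<lambda>\<omega>. conjugate (f \<omega>)) \<and>
         normal_integrand M weak_topology (\<lambda>\<omega>. biconjugate (f \<omega>))"
proof -
  have conj: "(\<lambda>(\<omega>, \<phi>). conjugate (f \<omega>) \<phi>) \<in> borel_measurable (M \<Otimes>\<^sub>M borel_of weak_star_topology)"
    by (rule borel_measurable_conjugate[OF assms])
  show ?thesis
    unfolding normal_integrand_def
    using conj borel_measurable_biconjugate[OF assms(1,2) conj]
      lower_semicontinuous_conjugate lower_semicontinuous_biconjugate by blast
qed

end
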